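(* Let $m=2k\ge4$ be an even integer, let $G=\langle s,t\mid \Pi(s,t,m)=\Pi(t,s,m)\rangle$ be the Artin group of type $I_2(m)$, let $M$ be the submonoid of $G$ generated by $\{s,t\}$, and let $\Delta=\Pi(s,t,m)=(st)^k=(ts)^k$. Let $G_1$ (resp. $M_1$) be the subgroup (resp. submonoid) generated by $t$, with $\Delta_1=t$, and let $H$ (resp. $N$) be the subgroup (resp. submonoid) generated by $s$, with $\Lambda=s$. Then, with respect to the Garside structure $(G,M,\Delta)$ and the parabolic substructures $(H,N,\Lambda)$ and $(G_1,M_1,\Delta_1)$, the pair $(H,G_1)$ satisfies Condition A with constant $\zeta=k-1$ and Condition B with constant $\zeta=k-1$.
   Context: $\Pi(s,t,m)$ denotes the alternating word $sts\cdots$ of length $m$. For $\alpha,\beta\in G$: $\alpha\le_R\beta$ iff $\beta\alpha^{-1}\in M$. It is known that $(G,M,\Delta)$ is a Garside structure with $\Delta$ central in $G$, and that $(G_1,M_1,\Delta_1)$ and $(H,N,\Lambda)$ are parabolic substructures of it. An element $a\in M$ is unmovable if $\Delta\not\le_R a$. Every $\alpha\in G$ is uniquely $\alpha=a\Delta^j$ with $a\in M$ unmovable and $j\in\mathbb Z$ (the $\Delta$-form of $\alpha$). Depth. For $K\in\{M_1,N\}$ and $a\in M$, $\tau_K(a)$ denotes the unique $b\in K$ with $\{c\in K\mid c\le_R a\}=\{c\in K\mid c\le_R b\}$. Every $a\in M\setminus\{1\}$ is uniquely $a=a_p\cdots a_2a_1$ with $a_p\ne1$, $a_i=\tau_{M_1}(a_p\cdots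 a_i)$ for $i$ odd and $a_i=\tau_N(a_p\cdots a_i)$ for $i$ even; set $\mathrm{bh}(a)=p$ and $\mathrm{bh}(1)=1$. The depth is $\mathrm{dpt}(a)=(\mathrm{bh}(a)-1)/2$ if $\mathrm{bh}(a)$ is odd and $\mathrm{bh}(a)/2$ if $\mathrm{bh}(a)$ is even. Conditions A and B. Condition A with constant $\zeta$: $\mathrm{dpt}(\Delta^j)=\zeta j+1$ for all $j\ge1$. Set $\theta=\Delta\Delta_1^{-1}=\Delta_1^{-1}\Delta\in M$, $\Theta=\{\theta^ja_0\mid j\ge1,\ a_0\in M_1\}$ and $\bar\Theta=\Theta\cup M_1$. Condition B with constant $\zeta$: for every $(a,b)\in(M\times M)\setminus(\bar\Theta\times\bar\Theta)$ with $a,b$ both unmovable, writing $ab=c\Delta^p$ for the $\Delta$-form of $ab$, there exists $\varepsilon\in\{0,1\}$ such that $\mathrm{dpt}(c)=\mathrm{dpt}(a)+\mathrm{dpt}(b)-\zeta p-\varepsilon$, and $\varepsilon=1$ if either $a\in\Theta$, or $b\in\Theta$, or $c\in M_1$. *)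

theory Defs
  imports "HOL-Algebra.Algebra"
begin

section \<open>Groups given by generators and relations\<close>

text \<open>
  A signed word over the generators \<open>'x\<close> is a list of pairs; \<open>(x, True)\<close> stands for the
  generator \<open>x\<close> and \<open>(x, False)\<close> for its formal inverse.
\<close>

type_synonym 'x sword = "('x \<times> bool) list"

inductive pres_eq :: "('x sword \<times> 'x sword) set \<Rightarrow> 'x sword \<Rightarrow> 'x sword \<Rightarrow> bool"
  for R :: "('x sword \<times> 'x sword) set"
where
  rel: "(u, v) \<in> R \<Longrightarrow> pres_eq R u v"
| cancel: "pres_eq R [(x, b), (x, \<not> b)] []"
| append: "pres_eq R u u' \<Longrightarrow> pres_eq R v v' \<Longrightarrow> pres_eq R (u @ v) (u' @ v')"
| refl: "pres_eq R u u"
| sym: "pres_eq R u v \<Longrightarrow> pres_eq R v u"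
| trans: "pres_eq R u v \<Longrightarrow> pres_eq R v w \<Longrightarrow> pres_eq R u w"

definition pres_class :: "('x sword \<times> 'x sword) set \<Rightarrow> 'x sword \<Rightarrow> 'x sword set" where
  "pres_class R u = {v. pres_eq R u v}"

definition presented_group :: "('x sword \<times> 'x sword) set \<Rightarrow> 'x sword set monoid" where
  "presented_group R =
     \<lparr> carrier = range (pres_class R),
       monoid.mult = (\<lambda>A B. \<Union>u\<in>A. \<Union>v\<in>B. pres_class R (u @ v)),
       monoid.one = pres_class R [] \<rparr>"

definition pos_word :: "'x list \<Rightarrow> 'x sword" where
  "pos_word = map (\<lambda>x. (x, True))"

definition pres_gen :: "('x sword \<times> 'x sword) set \<Rightarrow> 'x \<Rightarrow> 'x sword set" where
  "pres_gen R x = pres_class R (pos_word [x])"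


section \<open>Artin groups of dihedral type\<close>

fun alt_word :: "'x \<Rightarrow> 'x \<Rightarrow> nat \<Rightarrow> 'x list" where
  "alt_word x y 0 = []"
| "alt_word x y (Suc n) = x # alt_word y x n"

datatype gen = S | T

definition dihedral_rel :: "nat \<Rightarrow> (gen sword \<times> gen sword) set" where
  "dihedral_rel m = {(pos_word (alt_word S T m), pos_word (alt_word T S m))}"

definition dihedral_artin :: "nat \<Rightarrow> gen sword set monoid" where
  "dihedral_artin m = presented_group (dihedral_rel m)"


section \<open>Garside structures and parabolic substructures\<close>

definition list_mult :: "('a, 'b) monoid_scheme \<Rightarrow> 'a list \<Rightarrow> 'a" where
  "list_mult G xs = foldr (\<lambda>x y. x \<otimes>\<^bsub>G\<^esub> y) xs \<one>\<^bsub>G\<^esub>"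

inductive_set submonoid_generated :: "('a, 'b) monoid_scheme \<Rightarrow> 'a set \<Rightarrow> 'a set"
  for G :: "('a, 'b) monoid_scheme" and A :: "'a set"
where
  one: "\<one>\<^bsub>G\<^esub> \<in> submonoid_generated G A"
| incl: "x \<in> A \<Longrightarrow> x \<in> submonoid_generated G A"
| mult: "x \<in> submonoid_generated G A \<Longrightarrow> y \<in> submonoid_generated G A
           \<Longrightarrow> x \<otimes>\<^bsub>G\<^esub> y \<in> submonoid_generated G A"

text \<open>
  A triple such as \<open>(H, N, \<Lambda>)\<close> inside an ambient group: a subgroup, its positive monoid and its
  Garside element. The record carries data only; no axioms are imposed.
\<close>

record 'a substructure =
  subgrp :: "'a set"
  posmon :: "'a set"
  garside :: 'a

definition le_R :: "('a, 'b) monoid_scheme \<Rightarrow> 'a set \<Rightarrow> 'a \<Rightarrow> 'a \<Rightarrow> bool" where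
  "le_R G M \<alpha> \<beta> \<longleftrightarrow> \<beta> \<otimes>\<^bsub>G\<^esub> inv\<^bsub>G\<^esub> \<alpha> \<in> M"

definition unmovable :: "('a, 'b) monoid_scheme \<Rightarrow> 'a set \<Rightarrow> 'a \<Rightarrow> 'a \<Rightarrow> bool" where
  "unmovable G M \<Delta> a \<longleftrightarrow> a \<in> M \<and> \<not> le_R G M \<Delta> a"

definition delta_form :: "('a, 'b) monoid_scheme \<Rightarrow> 'a set \<Rightarrow> 'a \<Rightarrow> 'a \<Rightarrow> 'a \<times> int" where
  "delta_form G M \<Delta> \<alpha> =
     (THE (a, j). unmovable G M \<Delta> a \<and> \<alpha> = a \<otimes>\<^bsub>G\<^esub> \<Delta> [^]\<^bsub>G\<^esub> j)"


section \<open>Depth\<close>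

definition tail :: "('a, 'b) monoid_scheme \<Rightarrow> 'a set \<Rightarrow> 'a set \<Rightarrow> 'a \<Rightarrow> 'a" where
  "tail G M K a = (THE b. b \<in> K \<and> {c \<in> K. le_R G M c a} = {c \<in> K. le_R G M c b})"

text \<open>
  The list \<open>xs = [a\<^sub>1, a\<^sub>2, \<dots>, a\<^sub>p]\<close> runs through the factors of \<open>a = a\<^sub>p \<cdots> a\<^sub>2 a\<^sub>1\<close> from right to
  left, so that \<open>xs ! i\<close> is \<open>a\<^bsub>i+1\<^esub>\<close> and \<open>rev (drop i xs)\<close> multiplies out to \<open>a\<^sub>p \<cdots> a\<^bsub>i+1\<^esub>\<close>;
  odd indices of the factors are even list positions.
\<close>

definition alt_decomp ::
  "('a, 'b) monoid_scheme \<Rightarrow> 'a set \<Rightarrow> 'a set \<Rightarrow> 'a set \<Rightarrow> 'a \<Rightarrow> 'a list \<Rightarrow> bool" where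
  "alt_decomp G M N M\<^sub>1 a xs \<longleftrightarrow>
     set xs \<subseteq> M \<and> xs \<noteq> [] \<and> last xs \<noteq> \<one>\<^bsub>G\<^esub> \<and> a = list_mult G (rev xs) \<and>
     (\<forall>i < length xs.
        xs ! i = tail G M (if even i then M\<^sub>1 else N) (list_mult G (rev (drop i xs))))"

definition bh :: "('a, 'b) monoid_scheme \<Rightarrow> 'a set \<Rightarrow> 'a set \<Rightarrow> 'a set \<Rightarrow> 'a \<Rightarrow> nat" where
  "bh G M N M\<^sub>1 a =
     (if a = \<one>\<^bsub>G\<^esub> then 1 else length (THE xs. alt_decomp G M N M\<^sub>1 a xs))"

definition dpt :: "('a, 'b) monoid_scheme \<Rightarrow> 'a set \<Rightarrow> 'a set \<Rightarrow> 'a set \<Rightarrow> 'a \<Rightarrow> nat" where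
  "dpt G M N M\<^sub>1 a =
     (if odd (bh G M N M\<^sub>1 a) then (bh G M N M\<^sub>1 a - 1) div 2 else bh G M N M\<^sub>1 a div 2)"


section \<open>Conditions A and B\<close>

text \<open>
  In both conditions \<open>P\<close> is \<open>(H, N, \<Lambda>)\<close> and \<open>Q\<close> is \<open>(G\<^sub>1, M\<^sub>1, \<Delta>\<^sub>1)\<close>.
\<close>

definition condition_A ::
  "('a, 'b) monoid_scheme \<Rightarrow> 'a set \<Rightarrow> 'a \<Rightarrow> 'a substructure \<Rightarrow> 'a substructure \<Rightarrow> nat \<Rightarrow> bool"
where
  "condition_A G M \<Delta> P Q \<zeta> \<longleftrightarrow>
     (\<forall>j\<ge>1::nat. dpt G M (posmon P) (posmon Q) (\<Delta> [^]\<^bsub>G\<^esub> j) = \<zeta> * j + 1)"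

definition Theta :: "('a, 'b) monoid_scheme \<Rightarrow> 'a \<Rightarrow> 'a substructure \<Rightarrow> 'a set" where
  "Theta G \<Delta> Q =
     {(\<Delta> \<otimes>\<^bsub>G\<^esub> inv\<^bsub>G\<^esub> (garside Q)) [^]\<^bsub>G\<^esub> j \<otimes>\<^bsub>G\<^esub> a\<^sub>0 | (j::nat) a\<^sub>0. j \<ge> 1 \<and> a\<^sub>0 \<in> posmon Q}"

definition Theta_bar :: "('a, 'b) monoid_scheme \<Rightarrow> 'a \<Rightarrow> 'a substructure \<Rightarrow> 'a set" where
  "Theta_bar G \<Delta> Q = Theta G \<Delta> Q \<union> posmon Q"

definition condition_B ::
  "('a, 'b) monoid_scheme \<Rightarrow> 'a set \<Rightarrow> 'a \<Rightarrow> 'a substructure \<Rightarrow> 'a substructure \<Rightarrow> nat \<Rightarrow> bool"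
where
  "condition_B G M \<Delta> P Q \<zeta> \<longleftrightarrow>
     (\<forall>(a, b) \<in> (M \<times> M) - (Theta_bar G \<Delta> Q \<times> Theta_bar G \<Delta> Q).
        unmovable G M \<Delta> a \<and> unmovable G M \<Delta> b \<longrightarrow>
        (let (c, p) = delta_form G M \<Delta> (a \<otimes>\<^bsub>G\<^esub> b);
             d = (\<lambda>x. int (dpt G M (posmon P) (posmon Q) x))
         in \<exists>\<epsilon>\<in>{0, 1}. d c = d a + d b - int \<zeta> * p - \<epsilon> \<and>
              (a \<in> Theta G \<Delta> Q \<or> b \<in> Theta G \<Delta> Q \<or> c \<in> posmon Q \<longrightarrow> \<epsilon> = 1)))"

end

theory Submission
  imports Defs "HOL-Library.Sublist"
begin

text \<open>
  Call a positive word reduced if it has no alternating factor of length \<open>m = 2k\<close>. Since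
  \<open>\<Delta>\<close> is central and equals either alternating word of length \<open>m\<close>, every element of \<open>G\<close> is
  \<open>w \<Delta>\<^sup>j\<close> with \<open>w\<close> reduced; letting the letters act on such pairs \<open>(w, j)\<close> shows that
  \<open>w\<close> and \<open>j\<close> are unique. So the unmovable elements are exactly the reduced words, each with a
  single positive representative, and the depth of a reduced word is its number of maximal blocks
  of \<open>s\<close>. Condition A follows from \<open>\<Delta>\<^sup>j = \<theta>\<^sup>j t\<^sup>j\<close>, where the word of \<open>\<theta>\<^sup>j\<close> is reduced.
  For Condition B, multiply two reduced words by cancelling alternating factors of length \<open>m\<close> at
  the junction. Such a factor contains \<open>k\<close> blocks of \<open>s\<close>, one of which is shared with a
  neighbour as long as the cancellation can go on, so each cancellation costs \<open>k - 1\<close> blocks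
  and at most one further block is lost when the process stops.
\<close>

section \<open>Alternating and reduced words\<close>

fun other :: "gen \<Rightarrow> gen" where
  "other S = T"
| "other T = S"

lemma other_other [simp]: "other (other x) = x"
  by (cases x) auto

lemma other_eq_iff [simp]: "other x = other y \<longleftrightarrow> x = y"
  by (cases x; cases y) auto

lemma neq_iff_other: "x \<noteq> y \<longleftrightarrow> y = other x"
  by (cases x; cases y) auto

lemma other_neq [simp]: "other x \<noteq> x" "x \<noteq> other x"
  by (cases x; simp)+

abbreviation alternating :: "gen list \<Rightarrow> bool" where
  "alternating \<equiv> successively (\<noteq>)"

lemma length_alt_word [simp]: "length (alt_word x y n) = n"
  by (induction x y n rule: alt_word.induct) auto

lemma alternating_alt_word: "alternating (alt_word x (other x) n)"
proof (induction n arbitrary: x)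
  case (Suc n)
  from Suc[of "other x"] show ?case by (cases n) auto
qed simp

lemma alternating_eq_alt_word:
  "alternating (x # w) \<Longrightarrow> x # w = alt_word x (other x) (Suc (length w))"
proof (induction w arbitrary: x)
  case (Cons y w)
  from Cons.prems have "y = other x" "alternating (y # w)"
    by (auto simp: neq_iff_other)
  with Cons.IH[of y] show ?case by simp
qed simp

text \<open>With two letters, alternation makes the first letter recur at every odd position. The
  even case gives \<open>hd f \<noteq> last g\<close> for a factor \<open>f @ g\<close> of length
  \<open>2 * k\<close>, so exactly one end of it is \<open>S\<close>.\<close>

lemma hd_eq_last_alternating: "alternating w \<Longrightarrow> w \<noteq> [] \<Longrightarrow> hd w = last w \<longleftrightarrow> odd (length w)"
proof (induction w rule: induct_list012)
  case (3 x y w)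
  then show ?case by (cases x; cases y; cases "last (y # w)") auto
qed auto

lemma hd_alt_word: "n > 0 \<Longrightarrow> hd (alt_word x y n) = x"
  by (cases n) auto

lemma last_alt_word_odd: "odd n \<Longrightarrow> last (alt_word x (other x) n) = x"
  using hd_eq_last_alternating[OF alternating_alt_word, of x n] hd_alt_word[of n x]
  by (cases n) auto

section \<open>Counting blocks of \<open>s\<close> and runs in a word\<close>

fun s_blocks_after :: "gen \<Rightarrow> gen list \<Rightarrow> nat" where
  "s_blocks_after x [] = 0"
| "s_blocks_after x (y # w) = of_bool (x = T \<and> y = S) + s_blocks_after y w"

text \<open>\<open>s_blocks_after x\<close> counts a block at its first letter, with
  \<open>x\<close> the letter before the word; the virtual \<open>T\<close> in front makes an
  initial block of \<open>s\<close> count.\<close>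

definition s_blocks :: "gen list \<Rightarrow> nat" where
  "s_blocks w = s_blocks_after T w"

lemma s_blocks_after_append:
  "s_blocks_after x (p @ q) = s_blocks_after x p + s_blocks_after (if p = [] then x else last p) q"
  by (induction p arbitrary: x) auto

lemma s_blocks_after_S:
  "s_blocks_after S q + of_bool (q \<noteq> [] \<and> hd q = S) = s_blocks q"
  by (cases q) (auto simp: s_blocks_def)

text \<open>Concatenation loses a block only where two of them merge at the junction. The loss is
  added on the left, which avoids truncated subtraction.\<close>

lemma s_blocks_append:
  "s_blocks (p @ q) + of_bool (p \<noteq> [] \<and> q \<noteq> [] \<and> last p = S \<and> hd q = S) = s_blocks p + s_blocks q"
  using s_blocks_after_S[of q]
  by (cases "last p") (auto simp: s_blocks_def s_blocks_after_append)

lemma s_blocks_Nil [simp]: "s_blocks [] = 0"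
  by (simp add: s_blocks_def)

lemma s_blocks_single [simp]: "s_blocks [x] = of_bool (x = S)"
  by (simp add: s_blocks_def)

lemma s_blocks_rev: "s_blocks (rev w) = s_blocks w"
proof (induction w)
  case (Cons x w)
  then show ?case
    using s_blocks_append[of "[x]" w] s_blocks_append[of "rev w" "[x]"]
    by (cases "x = S \<and> w \<noteq> [] \<and> hd w = S") (auto simp: last_rev)
qed simp

lemma s_blocks_only_T: "set w \<subseteq> {T} \<Longrightarrow> s_blocks w = 0"
  unfolding s_blocks_def by (induction w) auto

lemma s_blocks_alternating:
  assumes "alternating w" and "length w = 2 * n"
  shows "s_blocks w = n"
proof -
  have ST: "s_blocks_after T (alt_word S T (2 * n)) = n" for n
    by (induction n) auto
  have TS: "s_blocks_after x (alt_word T S (2 * n)) = n" for n x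
    by (induction n arbitrary: x) auto
  show ?thesis
  proof (cases w)
    case (Cons x v)
    then have "w = alt_word x (other x) (2 * n)"
      using alternating_eq_alt_word[of x v] assms(1) assms(2)[symmetric] by simp
    then show ?thesis
      using ST TS by (cases x) (auto simp: s_blocks_def)
  qed (use assms in auto)
qed

text \<open>A possibly empty initial run of \<open>x\<close> counts as the first run.\<close>

fun runs_after :: "gen \<Rightarrow> gen list \<Rightarrow> nat" where
  "runs_after x [] = 1"
| "runs_after x (y # w) = (if x = y then runs_after x w else Suc (runs_after y w))"

text \<open>Runs alternate between \<open>T\<close> and \<open>S\<close>, beginning with
  \<open>T\<close>, so half of them, rounded down, are blocks of \<open>s\<close>. The depth is
  \<open>bh\<close> halved and rounded down in the same way.\<close>

lemma runs_after_s_blocks: "runs_after T w div 2 = s_blocks w"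
proof -
  \<comment> \<open>The induction needs the companion for \<open>S\<close>: the \<open>+ 1\<close>
    on the right is the current block of \<open>s\<close>, which \<open>s_blocks_after S\<close>
    does not count; the one on the left rounds up.\<close>
  have "runs_after T w div 2 = s_blocks_after T w \<and>
      (runs_after S w + 1) div 2 = s_blocks_after S w + 1"
  proof (induction w)
    case (Cons y w)
    then show ?case by (cases y) auto
  qed simp
  then show ?thesis by (simp add: s_blocks_def)
qed

lemma runs_after_replicate: "runs_after x (replicate i x @ w) = runs_after x w"
  by (induction i) auto

lemma trailing_runE:
  obtains w' i where "w = w' @ replicate i x" "w' = [] \<or> last w' \<noteq> x"
proof -
  have "\<exists>w' i. w = w' @ replicate i x \<and> (w' = [] \<or> last w' \<noteq> x)"
  proof (induction w rule: rev_induct)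
    case (snoc y w)
    show ?case
    proof (cases "y = x")
      case True
      from snoc obtain w' i where "w = w' @ replicate i x" "w' = [] \<or> last w' \<noteq> x" by blast
      with True show ?thesis
        by (intro exI[of _ w'] exI[of _ "Suc i"]) (simp add: replicate_append_same)
    next
      case False
      then show ?thesis by (intro exI[of _ "w @ [y]"] exI[of _ 0]) simp
    qed
  qed simp
  with that show thesis by blast
qed

section \<open>Reduced words and their products\<close>

locale dihedral =
  fixes k :: nat
  assumes k_ge_2: "k \<ge> 2"
begin

text \<open>Longer alternating factors are excluded as well, since they contain one of length
  exactly \<open>2 * k\<close>.\<close>

definition reduced :: "gen list \<Rightarrow> bool" where
  "reduced w \<longleftrightarrow> (\<forall>v. sublist v w \<longrightarrow> alternating v \<longrightarrow> length v \<noteq> 2 * k)"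

lemma reduced_Nil [simp]: "reduced []"
  using k_ge_2 by (auto simp: reduced_def)

lemma reduced_sublist: "reduced w \<Longrightarrow> sublist v w \<Longrightarrow> reduced v"
  unfolding reduced_def by (meson sublist_order.order_trans)

lemma reduced_appendD: "reduced (a @ b) \<Longrightarrow> reduced a \<and> reduced b"
  by (blast intro: reduced_sublist sublist_append_rightI sublist_append_leftI)

lemma reduced_ConsD: "reduced (x # w) \<Longrightarrow> reduced w"
  using reduced_appendD[of "[x]" w] by simp

lemma reduced_rev: "reduced (rev w) \<longleftrightarrow> reduced w"
proof -
  have "reduced w \<Longrightarrow> reduced (rev w)" for w
    unfolding reduced_def
  proof (intro allI impI)
    fix v assume *: "\<forall>v. sublist v w \<longrightarrow> alternating v \<longrightarrow> length v \<noteq> 2 * k"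
      "sublist v (rev w)" "alternating v"
    have "alternating (rev v)"
      using *(3) by (simp add: successively_rev eq_commute)
    then show "length v \<noteq> 2 * k"
      using *(1)[rule_format, of "rev v"] *(2) sublist_rev_right by force
  qed
  from this[of w] this[of "rev w"] show ?thesis by auto
qed

text \<open>A forbidden factor of \<open>a @ b\<close> lies in neither part, so it straddles the
  junction, as \<open>f @ g\<close>.\<close>

lemma not_reduced_appendE:
  assumes "reduced a" "reduced b" "\<not> reduced (a @ b)"
  obtains a' f g b' where "a = a' @ f" "b = g @ b'" "f \<noteq> []" "g \<noteq> []"
    "alternating (f @ g)" "length (f @ g) = 2 * k"
proof -
  obtain v where v: "sublist v (a @ b)" "alternating v" "length v = 2 * k"
    using assms(3) by (auto simp: reduced_def)
  have "\<not> sublist v a" "\<not> sublist v b"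
    using assms v by (auto simp: reduced_def)
  then obtain f g where fg: "v = f @ g" "suffix f a" "prefix g b"
    using v(1) by (auto simp: sublist_append)
  with \<open>\<not> sublist v a\<close> \<open>\<not> sublist v b\<close> have "f \<noteq> []" "g \<noteq> []"
    using prefix_imp_sublist suffix_imp_sublist by auto
  with fg v that show thesis by (auto simp: suffix_def prefix_def)
qed

lemma reduced_append:
  assumes "reduced a" "reduced b" "a = [] \<or> b = [] \<or> last a = hd b"
  shows "reduced (a @ b)"
proof (rule ccontr)
  assume "\<not> reduced (a @ b)"
  with assms(1,2) show False
  proof (rule not_reduced_appendE)
    fix a' f g b'
    assume "a = a' @ f" "b = g @ b'" "f \<noteq> []" "g \<noteq> []" "alternating (f @ g)"
    with assms(3) show False by (auto simp: successively_append_iff)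
  qed
qed

lemma reduced_short: "length w < 2 * k \<Longrightarrow> reduced w"
  by (auto simp: reduced_def dest!: sublist_length_le)

lemma reduced_replicate: "reduced (replicate n x)"
proof (induction n)
  case (Suc n)
  then show ?case
    using reduced_append[of "[x]" "replicate n x"] reduced_short[of "[x]"] k_ge_2
    by (cases n) auto
qed simp

text \<open>Choosing \<open>f\<close> as short as possible makes \<open>g\<close> end where the alternation of \<open>b\<close> breaks.\<close>

lemma not_reduced_append_maximalE:
  assumes "reduced a" "reduced b" "\<not> reduced (a @ b)"
  obtains a' f g b' where "a = a' @ f" "b = g @ b'" "f \<noteq> []" "g \<noteq> []"
    "alternating (f @ g)" "length (f @ g) = 2 * k" "b' = [] \<or> hd b' = last g"
proof -
  define P where "P f a' g b' \<longleftrightarrow> a = a' @ f \<and> b = g @ b' \<and> f \<noteq> [] \<and> g \<noteq> [] \<and>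
    alternating (f @ g) \<and> length (f @ g) = 2 * k" for f a' g b'
  have "\<exists>f. \<exists>a' g b'. P f a' g b'"
    using assms by (rule not_reduced_appendE) (auto simp: P_def)
  from arg_min_natI[of "\<lambda>f. \<exists>a' g b'. P f a' g b'" _ length]
    arg_min_nat_le[of "\<lambda>f. \<exists>a' g b'. P f a' g b'" _ length] this
  obtain f a' g b' where P: "P f a' g b'"
    and min: "\<And>f' a' g b'. P f' a' g b' \<Longrightarrow> length f \<le> length f'"
    by metis
  have "b' = [] \<or> hd b' = last g"
  proof (rule ccontr)
    assume "\<not> ?thesis"
    then obtain y q where y: "b' = y # q" "y \<noteq> last g"
      by (cases b') auto
    obtain z f' where z: "f = z # f'"
      using P by (cases f) (auto simp: P_def)
    have alt: "alternating (f' @ g @ [y])"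
      using P y z by (auto simp: P_def successively_append_iff successively_Cons)
    \<comment> \<open>The window has moved one letter to the right. Were nothing of it left in
      \<open>a\<close>, it would lie inside the reduced word \<open>b\<close>; otherwise the shorter
      \<open>f'\<close> contradicts minimality.\<close>
    have "f' \<noteq> []"
    proof
      assume "f' = []"
      with P y z alt have "alternating (g @ [y])" "length (g @ [y]) = 2 * k" "b = (g @ [y]) @ q"
        by (auto simp: P_def)
      with assms(2) show False unfolding reduced_def by blast
    qed
    with P y z alt have "P f' (a' @ [z]) (g @ [y]) q" by (auto simp: P_def)
    from min[OF this] z show False by simp
  qed
  with P that show thesis by (auto simp: P_def)
qed

text \<open>\<open>p\<close> counts the deleted factors. Each of them represents
  \<open>\<Delta>\<close>, and as \<open>\<Delta>\<close> is central the place of deletion does not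
  matter: \<open>w\<close> and \<open>c \<Delta>^p\<close> are the same element.\<close>

inductive collapses :: "gen list \<Rightarrow> gen list \<Rightarrow> nat \<Rightarrow> bool" where
  base: "collapses w w 0"
| step: "alternating f \<Longrightarrow> length f = 2 * k \<Longrightarrow> collapses (u @ v) c p
    \<Longrightarrow> collapses (u @ f @ v) c (Suc p)"

lemma collapses_rev: "collapses w c p \<Longrightarrow> collapses (rev w) (rev c) p"
proof (induction rule: collapses.induct)
  case (step f u v c p)
  have "alternating (rev f)"
    using step.hyps by (simp add: successively_rev eq_commute)
  from collapses.step[OF this, of "rev v" "rev u"] step show ?case by simp
qed (rule collapses.base)

text \<open>This is the combinatorial core of Condition B: \<open>e\<close> becomes the defect
  \<open>\<epsilon>\<close>, and the last clause serves the case where \<open>c\<close> is a power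
  of \<open>t\<close>. The induction deletes a factor at the junction and passes to what remains on
  both sides.\<close>

lemma product_s_blocks:
  assumes "reduced a" "reduced b"
  shows "\<exists>c p e. reduced c \<and> collapses (a @ b) c p \<and> e \<le> 1 \<and>
    s_blocks c + (k - 1) * p + e = s_blocks a + s_blocks b \<and>
    (set c \<subseteq> {T} \<longrightarrow> e = 1 \<or> set a \<subseteq> {T} \<and> set b \<subseteq> {T})"
  using assms
proof (induction "length a" arbitrary: a b rule: less_induct)
  case less
  define e where
    "e a b = (of_bool (a \<noteq> [] \<and> b \<noteq> [] \<and> last a = S \<and> hd b = S) :: nat)" for a b
  have e: "s_blocks (a @ b) + e a b = s_blocks a + s_blocks b" for a b
    unfolding e_def by (rule s_blocks_append)
  show ?case
  proof (cases "reduced (a @ b)")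
    case True
    have "collapses (a @ b) (a @ b) 0 \<and> e a b \<le> 1"
      by (auto simp: e_def intro: collapses.base)
    with True e[of a b] show ?thesis
      by (intro exI[of _ "a @ b"] exI[of _ 0] exI[of _ "e a b"]) auto
  next
    case False
    with less.prems obtain a' f g b' where ab: "a = a' @ f" "b = g @ b'" "f \<noteq> []" "g \<noteq> []"
      and fg: "alternating (f @ g)" "length (f @ g) = 2 * k"
      and b': "b' = [] \<or> hd b' = last g"
      by (rule not_reduced_append_maximalE)
    have red: "reduced a'" "reduced b'"
      using ab less.prems reduced_appendD by blast+
    have step: "collapses (a @ b) c (Suc p)" if "collapses (a' @ b') c p" for c p
      using collapses.step[OF fg that] ab by simp
    have "hd f \<noteq> last g"
      using hd_eq_last_alternating[OF fg(1)] fg(2) ab(3,4) by (simp del: length_append)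
    have "e f g = 0"
      using fg(1) ab by (auto simp: e_def successively_append_iff)
    \<comment> \<open>Deleting \<open>f @ g\<close> removes its \<open>k\<close> blocks, except that
      a block it shares with \<open>a'\<close> or \<open>b'\<close> survives there.\<close>
    then have blocks: "s_blocks a + s_blocks b + e a' f + e g b' = s_blocks a' + s_blocks b' + k"
      using e[of a' f] e[of g b'] e[of f g] s_blocks_alternating[OF fg] ab by simp
    show ?thesis
    proof (cases "e a' f = 0 \<and> e g b' = 0")
      case True
      \<comment> \<open>If \<open>last g\<close> is \<open>S\<close>, maximality and the absence of
        a shared block leave only \<open>b' = []\<close>; if \<open>hd f\<close> is
        \<open>S\<close>, both neighbours are \<open>T\<close> or absent. Either way the
        cancellation stops here, with loss \<open>k = (k - 1) + 1\<close>.\<close>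
      have *: "a' = [] \<or> b' = [] \<or> (last a' = T \<and> hd b' = T)"
        using True b' ab \<open>hd f \<noteq> last g\<close>
        by (cases "last a'"; cases "hd f"; cases "last g") (auto simp: e_def)
      then have "reduced (a' @ b')"
        using red by (intro reduced_append) auto
      moreover have "s_blocks (a' @ b') = s_blocks a' + s_blocks b'"
        using e[of a' b'] * by (auto simp: e_def)
      moreover have "collapses (a @ b) (a' @ b') 1"
        using step[OF collapses.base] by simp
      ultimately show ?thesis
        using blocks True k_ge_2
        by (intro exI[of _ "a' @ b'"] exI[of _ 1] exI[of _ 1]) auto
    next
      case False
      \<comment> \<open>The ends of \<open>f @ g\<close> differ, so only one block is shared; the
        net loss is \<open>k - 1\<close>, and the defect is inherited from \<open>a'\<close> and
        \<open>b'\<close>.\<close>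
      then have one: "e a' f + e g b' = 1"
        using \<open>hd f \<noteq> last g\<close> by (auto simp: e_def)
      \<comment> \<open>The shared block leaves an \<open>S\<close> in \<open>a'\<close> or
        \<open>b'\<close>, so the last clause of the induction hypothesis yields
        \<open>e = 1\<close> whenever \<open>c\<close> is a power of \<open>t\<close>.\<close>
      have "\<not> (set a' \<subseteq> {T} \<and> set b' \<subseteq> {T})"
      proof
        assume "set a' \<subseteq> {T} \<and> set b' \<subseteq> {T}"
        then have "a' \<noteq> [] \<longrightarrow> last a' = T" "b' \<noteq> [] \<longrightarrow> hd b' = T"
          using last_in_set[of a'] hd_in_set[of b'] by blast+
        with False show False by (auto simp: e_def)
      qed
      moreover obtain c p e where "reduced c" "collapses (a' @ b') c p" "e \<le> 1"
        "s_blocks c + (k - 1) * p + e = s_blocks a' + s_blocks b'"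
        "set c \<subseteq> {T} \<longrightarrow> e = 1 \<or> set a' \<subseteq> {T} \<and> set b' \<subseteq> {T}"
        using less.hyps[of a' b'] red ab by auto
      moreover have "(k - 1) * Suc p + 1 = (k - 1) * p + k"
        using k_ge_2 by simp
      ultimately show ?thesis
        using step[of c p] blocks one
        by (intro exI[of _ c] exI[of _ "Suc p"] exI[of _ e]) auto
    qed
  qed
qed

section \<open>The word of \<open>\<theta>^j\<close>, where \<open>\<theta> = (st)^(k-1) s\<close>,
  and products with it\<close>

definition theta_word :: "nat \<Rightarrow> gen list" where
  "theta_word j = concat (replicate j (alt_word S T (2 * k - 1)))"

lemma theta_word_0 [simp]: "theta_word 0 = []"
  by (simp add: theta_word_def)

lemma theta_word_Suc: "theta_word (Suc j) = alt_word S T (2 * k - 1) @ theta_word j"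
  by (simp add: theta_word_def)

lemma theta_word_Suc': "theta_word (Suc j) = theta_word j @ alt_word S T (2 * k - 1)"
  by (induction j) (simp_all add: theta_word_Suc)

lemma theta_word_1: "theta_word (Suc 0) = alt_word S T (2 * k - 1)"
  by (simp add: theta_word_Suc)

lemma alternating_theta: "alternating (alt_word S T (2 * k - 1))"
  using alternating_alt_word[of S] by simp

lemma last_theta: "last (alt_word S T (2 * k - 1)) = S"
  using last_alt_word_odd[of "2 * k - 1" S] k_ge_2 by simp

lemma theta_nonempty: "alt_word S T (2 * k - 1) \<noteq> []"
  using k_ge_2 by (cases "2 * k - 1") auto

lemma theta_word_neq_Nil: "j > 0 \<Longrightarrow> theta_word j \<noteq> []"
  using theta_nonempty by (cases j) (auto simp: theta_word_Suc)

lemma last_theta_word: "j > 0 \<Longrightarrow> last (theta_word j) = S"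
  using last_theta theta_nonempty by (cases j) (auto simp: theta_word_Suc')

lemma reduced_theta_word: "reduced (theta_word j)"
proof (induction j)
  case (Suc j)
  have "hd (alt_word S T (2 * k - 1)) = S"
    using k_ge_2 by (intro hd_alt_word) auto
  with Suc last_theta_word[of j] show ?case
    unfolding theta_word_Suc' using k_ge_2
    by (intro reduced_append) (cases j; auto intro!: reduced_short)+
qed simp

lemma alternating_theta_T:
  "alternating (alt_word S T (2 * k - 1) @ [T])" "length (alt_word S T (2 * k - 1) @ [T]) = 2 * k"
  using alternating_theta last_theta k_ge_2 by (auto simp: successively_append_iff)

lemma s_blocks_theta: "s_blocks (alt_word S T (2 * k - 1)) = k"
  using s_blocks_append[of "alt_word S T (2 * k - 1)" "[T]"]
    s_blocks_alternating[OF alternating_theta_T] by simp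

text \<open>Each copy has \<open>k\<close> blocks, and adjacent copies share one because they begin
  and end with \<open>S\<close>.\<close>

lemma s_blocks_theta_word: "j > 0 \<Longrightarrow> s_blocks (theta_word j) = (k - 1) * j + 1"
proof (induction j)
  case (Suc j)
  show ?case
  proof (cases "j = 0")
    case True
    then show ?thesis using s_blocks_theta k_ge_2 by (simp add: theta_word_1)
  next
    case False
    have "hd (alt_word S T (2 * k - 1)) = S"
      using k_ge_2 by (intro hd_alt_word) auto
    then show ?thesis
      using Suc.IH False k_ge_2 s_blocks_append[of "theta_word j" "alt_word S T (2 * k - 1)"]
        last_theta_word[of j] theta_word_neq_Nil[of j] theta_nonempty s_blocks_theta
      by (simp add: theta_word_Suc')
  qed
qed simp

lemma rev_theta_word: "rev (theta_word j) = theta_word j"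
proof -
  have "rev (alt_word S T (2 * k - 1)) = alt_word S T (2 * k - 1)"
  proof -
    define r where "r = rev (alt_word S T (2 * k - 1))"
    have "alternating r" "r \<noteq> []" "length r = 2 * k - 1" "hd r = S"
      using alternating_theta last_theta theta_nonempty
      by (auto simp: r_def successively_rev eq_commute hd_rev)
    then have "r = alt_word S T (2 * k - 1)"
      using alternating_eq_alt_word[of S "tl r"] by (cases r) auto
    then show ?thesis by (simp add: r_def)
  qed
  then show ?thesis by (simp add: theta_word_def rev_concat)
qed

text \<open>If \<open>b\<close> starts with \<open>S\<close>, nothing cancels and one block merges.
  If it starts with \<open>T\<close>, the last \<open>\<theta>\<close> and this \<open>T\<close>
  make \<open>\<Delta>\<close>, and the rest of \<open>b\<close> meets
  \<open>\<theta>^(j-1)\<close>. The \<open>S\<close> in \<open>b\<close> survives each such step;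
  for \<open>b = []\<close>, by contrast, nothing would be lost.\<close>

lemma theta_product_s_blocks:
  assumes "reduced b" "\<not> set b \<subseteq> {T}" "j > 0"
  shows "\<exists>c p. reduced c \<and> collapses (theta_word j @ b) c p \<and>
    s_blocks c + (k - 1) * p + 1 = s_blocks (theta_word j) + s_blocks b"
  using assms
proof (induction j arbitrary: b)
  case (Suc j)
  have app: ?case if "hd b = S"
  proof -
    from Suc.prems have "b \<noteq> []" by auto
    then have "reduced (theta_word (Suc j) @ b)"
      using Suc.prems(1) last_theta_word[of "Suc j"] that
      by (intro reduced_append reduced_theta_word) auto
    then show ?thesis
      using s_blocks_append[of "theta_word (Suc j)" b] that \<open>b \<noteq> []\<close>
        last_theta_word[of "Suc j"] theta_word_neq_Nil[of "Suc j"]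
      by (intro exI[of _ "theta_word (Suc j) @ b"] exI[of _ 0]) (auto intro: collapses.base)
  qed
  show ?case
  proof (cases "hd b")
    case T
    with Suc.prems(2) obtain b' where b: "b = T # b'" "\<not> set b' \<subseteq> {T}"
      by (cases b) auto
    then have "b' \<noteq> []" by auto
    have red: "reduced b'"
      using Suc.prems(1) b reduced_ConsD by blast
    have step: "collapses (theta_word (Suc j) @ b) c (Suc p)"
      if "collapses (theta_word j @ b') c p" for c p
      using collapses.step[OF alternating_theta_T that] b by (simp add: theta_word_Suc')
    have blocks: "s_blocks b = s_blocks b'"
      using s_blocks_append[of "[T]" b'] b by simp
    show ?thesis
    proof (cases "j = 0")
      \<comment> \<open>No copy of \<open>\<theta>\<close> is left, so all its \<open>k\<close>
        blocks are gone: \<open>k - 1\<close> for the \<open>\<Delta>\<close> split off, and the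
        defect 1.\<close>
      case True
      then show ?thesis
        using step[of b' 0] collapses.base[of b'] red blocks s_blocks_theta_word[of 1]
        by (intro exI[of _ b'] exI[of _ 1]) auto
    next
      case False
      then obtain c p where "reduced c" "collapses (theta_word j @ b') c p"
        "s_blocks c + (k - 1) * p + 1 = s_blocks (theta_word j) + s_blocks b'"
        using Suc.IH[OF red b(2)] by auto
      then show ?thesis
        using step[of c p] blocks False s_blocks_theta_word[of j] s_blocks_theta_word[of "Suc j"]
        by (intro exI[of _ c] exI[of _ "Suc p"]) auto
    qed
  qed (rule app)
qed simp

text \<open>Reversal exchanges the two sides, and \<open>theta_word j\<close> is a
  palindrome.\<close>

lemma product_theta_s_blocks:
  assumes "reduced a" "\<not> set a \<subseteq> {T}" "j > 0"
  shows "\<exists>c p. reduced c \<and> collapses (a @ theta_word j) c p \<and>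
    s_blocks c + (k - 1) * p + 1 = s_blocks a + s_blocks (theta_word j)"
proof -
  obtain c p where "reduced c" and c: "collapses (theta_word j @ rev a) c p"
    "s_blocks c + (k - 1) * p + 1 = s_blocks (theta_word j) + s_blocks (rev a)"
    using theta_product_s_blocks[of "rev a" j] assms by (auto simp: reduced_rev)
  then show ?thesis
    using collapses_rev[OF c(1)]
    by (intro exI[of _ "rev c"] exI[of _ p]) (auto simp: reduced_rev rev_theta_word s_blocks_rev)
qed

end

section \<open>Presented groups and the action on normal forms\<close>

lemma pres_class_eq_iff: "pres_class R u = pres_class R v \<longleftrightarrow> pres_eq R u v"
  unfolding pres_class_def set_eq_iff mem_Collect_eq
  by (meson pres_eq.refl pres_eq.sym pres_eq.trans)

lemma mult_presented_group:
  "pres_class R u \<otimes>\<^bsub>presented_group R\<^esub> pres_class R v = pres_class R (u @ v)"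
proof -
  have "pres_class R (u' @ v') = pres_class R (u @ v)"
    if "u' \<in> pres_class R u" "v' \<in> pres_class R v" for u' v'
    using that unfolding pres_class_eq_iff
    by (simp add: pres_class_def pres_eq.append pres_eq.sym)
  moreover have "u \<in> pres_class R u" "v \<in> pres_class R v"
    by (auto simp: pres_class_def intro: pres_eq.refl)
  ultimately have "(\<Union>u'\<in>pres_class R u. \<Union>v'\<in>pres_class R v. pres_class R (u' @ v')) =
      pres_class R (u @ v)"
    by (intro SUP_eq_const) blast+
  then show ?thesis by (simp add: presented_group_def)
qed

lemma pres_eq_inverse: "pres_eq R (rev (map (\<lambda>(x, b). (x, \<not> b)) u) @ u) []"
proof (induction u)
  case (Cons l u)
  obtain x b where l: "l = (x, b)" by (cases l)
  let ?v = "rev (map (\<lambda>(x, b). (x, \<not> b)) u)"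
  have "pres_eq R [(x, \<not> b), (x, b)] []"
    using pres_eq.cancel[of R x "\<not> b"] by simp
  then have "pres_eq R (?v @ ([(x, \<not> b), (x, b)] @ u)) (?v @ ([] @ u))"
    by (intro pres_eq.append pres_eq.refl)
  with Cons l show ?case by (auto intro: pres_eq.trans)
qed (auto intro: pres_eq.refl)

lemma group_presented_group: "group (presented_group R)"
proof (rule groupI)
  show "\<one>\<^bsub>presented_group R\<^esub> \<in> carrier (presented_group R)"
    by (simp add: presented_group_def)
next
  fix x y assume "x \<in> carrier (presented_group R)" "y \<in> carrier (presented_group R)"
  then obtain u v where "x = pres_class R u" "y = pres_class R v"
    by (auto simp: presented_group_def)
  then show "x \<otimes>\<^bsub>presented_group R\<^esub> y \<in> carrier (presented_group R)"
    by (simp only: mult_presented_group) (simp add: presented_group_def)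
next
  fix x y z
  assume "x \<in> carrier (presented_group R)" "y \<in> carrier (presented_group R)"
    "z \<in> carrier (presented_group R)"
  then obtain u v w where "x = pres_class R u" "y = pres_class R v" "z = pres_class R w"
    by (auto simp: presented_group_def)
  then show "x \<otimes>\<^bsub>presented_group R\<^esub> y \<otimes>\<^bsub>presented_group R\<^esub> z =
      x \<otimes>\<^bsub>presented_group R\<^esub> (y \<otimes>\<^bsub>presented_group R\<^esub> z)"
    by (simp add: mult_presented_group)
next
  fix x assume "x \<in> carrier (presented_group R)"
  then obtain u where u: "x = pres_class R u" by (auto simp: presented_group_def)
  have one: "\<one>\<^bsub>presented_group R\<^esub> = pres_class R []" by (simp add: presented_group_def)
  show "\<one>\<^bsub>presented_group R\<^esub> \<otimes>\<^bsub>presented_group R\<^esub> x = x"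
    by (simp add: one u mult_presented_group)
  have "pres_class R (rev (map (\<lambda>(x, b). (x, \<not> b)) u)) \<otimes>\<^bsub>presented_group R\<^esub> x =
      \<one>\<^bsub>presented_group R\<^esub>"
    by (simp add: one u mult_presented_group pres_class_eq_iff pres_eq_inverse)
  then show "\<exists>y\<in>carrier (presented_group R).
      y \<otimes>\<^bsub>presented_group R\<^esub> x = \<one>\<^bsub>presented_group R\<^esub>"
    by (auto simp: presented_group_def)
qed

lemma pos_word_append: "pos_word (u @ v) = pos_word u @ pos_word v"
  by (simp add: pos_word_def)

lemma Cons_alt_word_even:
  "x # alt_word (other x) x (2 * n) = alt_word x (other x) (2 * n) @ [x]"
  by (induction n) auto

lemma alternating_prefixE:
  assumes "w \<noteq> []"
  obtains f q where "w = f @ q" "f \<noteq> []" "alternating f" "q = [] \<or> hd q = last f"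
  using assms
proof (induction w arbitrary: thesis)
  case (Cons x w)
  show ?case
  proof (cases "w = [] \<or> hd w = x")
    case True
    then show ?thesis using Cons.prems(1)[of "[x]" w] by auto
  next
    case False
    with Cons.IH obtain f q where
      "w = f @ q" "f \<noteq> []" "alternating f" "q = [] \<or> hd q = last f" by blast
    with False show ?thesis
      by (intro Cons.prems(1)[of "x # f" q]) (auto simp: successively_Cons)
  qed
qed simp

section \<open>The action of the letters on normal forms\<close>

context dihedral
begin

text \<open>As \<open>w\<close> is reduced, the forbidden factor starts at the new letter
  \<open>x\<close>. If the letter after it continued the alternation, \<open>w\<close> would contain
  the factor shifted by one. The condition on \<open>q\<close> is what lets the inverse letter
  restore \<open>w\<close>.\<close>

lemma not_reduced_ConsE:
  assumes "reduced w" "\<not> reduced (x # w)"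
  obtains q where "w = alt_word (other x) x (2 * k - 1) @ q" "q = [] \<or> hd q = other x"
proof -
  obtain f g where w: "[x] @ w = f @ g" and f: "alternating f" "length f = 2 * k"
    using assms unfolding reduced_def
    by (auto simp: sublist_Cons_right prefix_def)
  obtain f' where f': "f = x # f'"
    using w f k_ge_2 by (cases f) auto
  have f'_eq: "f' = alt_word (other x) x (2 * k - 1)"
  proof -
    have "length f' = 2 * k - 1" using f f' by simp
    then show ?thesis using alternating_eq_alt_word[of x f'] f f' by simp
  qed
  have last: "last f' = other x"
    using last_alt_word_odd[of "2 * k - 1" "other x"] f'_eq k_ge_2 by simp
  have "g = [] \<or> hd g = other x"
  proof (rule ccontr)
    assume "\<not> ?thesis"
    then obtain g' where g': "g = x # g'"
      by (cases g) (auto simp: neq_iff_other)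
    have "f' \<noteq> []"
      using f f' k_ge_2 by auto
    with f f' last have "alternating (f' @ [x])" "length (f' @ [x]) = 2 * k"
      by (auto simp: successively_append_iff successively_Cons)
    moreover have "sublist (f' @ [x]) w"
      using w f' g' by (auto simp: sublist_def)
    ultimately show False
      using assms(1) by (auto simp: reduced_def)
  qed
  with w f' f'_eq that show thesis by auto
qed

lemma not_reduced_Cons_alt_word:
  "\<not> reduced (x # alt_word (other x) x (2 * k - 1) @ q)"
proof -
  have "x # alt_word (other x) x (2 * k - 1) @ q = alt_word x (other x) (2 * k) @ q"
    using k_ge_2 by (cases "2 * k") auto
  then show ?thesis
    using alternating_alt_word[of x "2 * k"] length_alt_word[of x "other x" "2 * k"]
    unfolding reduced_def by (metis sublist_append_rightI)
qed

lemma reduced_alt_word_append: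
  assumes "reduced w" "w = [] \<or> hd w = other x"
  shows "reduced (alt_word (other x) x (2 * k - 1) @ w)"
proof (rule reduced_append)
  show "reduced (alt_word (other x) x (2 * k - 1))"
    using k_ge_2 by (intro reduced_short) simp
  show "alt_word (other x) x (2 * k - 1) = [] \<or> w = [] \<or>
      last (alt_word (other x) x (2 * k - 1)) = hd w"
    using assms(2) last_alt_word_odd[of "2 * k - 1" "other x"] k_ge_2 by auto
qed (rule assms(1))

text \<open>Left multiplication by a letter, read off on pairs \<open>(w, j)\<close> standing for
  \<open>w \<Delta>\<^sup>j\<close> with \<open>w\<close> reduced.\<close>

fun act :: "gen \<times> bool \<Rightarrow> gen list \<times> int \<Rightarrow> gen list \<times> int" where
  "act (x, True) (w, j) =
     (if reduced (x # w) then (x # w, j) else (drop (2 * k - 1) w, j + 1))"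
| "act (x, False) (w, j) =
     (if w \<noteq> [] \<and> hd w = x then (tl w, j) else (alt_word (other x) x (2 * k - 1) @ w, j - 1))"

lemma reduced_act: "reduced w \<Longrightarrow> reduced (fst (act l (w, j)))"
proof (cases l)
  case (Pair x b)
  assume w: "reduced w"
  show ?thesis
  proof (cases b)
    case True
    with w Pair show ?thesis
      by (auto elim: not_reduced_ConsE intro: reduced_sublist[OF _ sublist_drop])
  next
    case False
    have "reduced (tl w)"
      using w by (rule reduced_sublist) (rule sublist_tl)
    moreover have "reduced (alt_word (other x) x (2 * k - 1) @ w)" if "w = [] \<or> hd w \<noteq> x"
      using w that by (intro reduced_alt_word_append) (auto simp: neq_iff_other dest: not_sym)
    ultimately show ?thesis
      using False Pair by auto
  qed
qed

lemma act_cancel: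
  assumes "reduced w"
  shows "act (x, b) (act (x, \<not> b) (w, j)) = (w, j)"
proof (cases b)
  case True
  show ?thesis
  proof (cases "w \<noteq> [] \<and> hd w = x")
    case starts: True
    then have "x # tl w = w" by auto
    with True starts assms show ?thesis by simp
  next
    case not: False
    \<comment> \<open>The inverse letter prepends the word of \<open>x^(-1) \<Delta>\<close>;
      \<open>x\<close> completes it to \<open>\<Delta>\<close>, so \<open>act\<close> drops it
      again.\<close>
    show ?thesis
      using True not not_reduced_Cons_alt_word[of x w] by (simp split del: if_split add: if_not_P)
  qed
next
  case False
  show ?thesis
  proof (cases "reduced (x # w)")
    case not: False
    with assms obtain q where "w = alt_word (other x) x (2 * k - 1) @ q" "q = [] \<or> hd q = other x"
      by (rule not_reduced_ConsE)
    with not False show ?thesis by auto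
  qed (use False in auto)
qed

lemma foldr_act_reduced:
  "reduced (u @ w) \<Longrightarrow> foldr act (pos_word u) (w, j) = (u @ w, j)"
proof (induction u)
  case (Cons x u)
  moreover have "reduced (u @ w)"
    using Cons.prems reduced_ConsD[of x "u @ w"] by simp
  ultimately show ?case by (simp add: pos_word_def)
qed (simp add: pos_word_def)

text \<open>The result is the same for both choices of \<open>x\<close>, so the two sides of the
  defining relation act alike.\<close>

lemma foldr_act_delta:
  assumes "reduced w"
  shows "foldr act (pos_word (alt_word x (other x) (2 * k))) (w, j) = (w, j + 1)"
proof -
  \<comment> \<open>The direct case: all letters but the first extend \<open>q\<close> to a reduced
    word, and the first one triggers the drop.\<close>
  have collapse: "foldr act (pos_word f) (q, j) = (q, j + 1)"
    if f: "alternating f" "length f = 2 * k" and q: "reduced q" "q = [] \<or> hd q = last f" for f q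
  proof -
    obtain z f' where z: "f = z # f'"
      using f k_ge_2 by (cases f) auto
    moreover have "length f' = 2 * k - 1" using f z by simp
    ultimately have "f' = alt_word (other z) z (2 * k - 1)"
      using alternating_eq_alt_word[of z f'] f by simp
    moreover have "reduced (f' @ q)"
    proof (rule reduced_append)
      show "reduced f'" using f z by (intro reduced_short) auto
      have "f' \<noteq> []" using f z k_ge_2 by auto
      then show "f' = [] \<or> q = [] \<or> last f' = hd q" using q z by auto
    qed (rule q)
    ultimately show ?thesis
      using foldr_act_reduced[of f' q j] not_reduced_Cons_alt_word[of z q] z
      by (simp add: pos_word_def)
  qed
  let ?D = "alt_word x (other x) (2 * k)"
  have D: "alternating ?D" "length ?D = 2 * k" "hd ?D = x"
    using alternating_alt_word k_ge_2 hd_alt_word[of "2 * k" x "other x"] by auto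
  have "?D \<noteq> []"
    using D(2) k_ge_2 by (metis list.size(3) mult_eq_0_iff not_numeral_le_zero zero_neq_numeral)
  have last: "last ?D = other x"
    using hd_eq_last_alternating[OF D(1) \<open>?D \<noteq> []\<close>] D by (auto simp: neq_iff_other)
  show ?thesis
  proof (cases "w = [] \<or> hd w = other x")
    case True
    then show ?thesis using collapse[OF D(1,2) assms] last by auto
  next
    case False
    then obtain f q where w: "w = f @ q" and f: "f \<noteq> []" "alternating f" "q = [] \<or> hd q = last f"
      using alternating_prefixE[of w] by metis
    have "hd f = x"
      using False w f by (auto simp: neq_iff_other)
    then obtain f' where "f = x # f'" using f by (cases f) auto
    then have f_alt: "f = alt_word x (other x) (length f)"
      using alternating_eq_alt_word[of x f'] f by auto
    have "\<not> length f \<ge> 2 * k"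
    proof
      assume *: "length f \<ge> 2 * k"
      have "alternating (take (2 * k) f)"
        using f(2) successively_append_iff[of "(\<noteq>)" "take (2 * k) f" "drop (2 * k) f"] by simp
      moreover have "sublist (take (2 * k) f) w"
        using w by (metis append_take_drop_id append.assoc sublist_append_rightI)
      ultimately show False
        using assms * by (auto simp: reduced_def)
    qed
    then have len: "length f < 2 * k" by simp
    \<comment> \<open>Split the word of \<open>\<Delta>\<close> as \<open>f @ g\<close>, with
      \<open>f\<close> the longest alternating prefix of \<open>w\<close>. As \<open>f\<close>
      acting on \<open>q\<close> yields \<open>w\<close>, applying \<open>g\<close> to
      \<open>w\<close> means applying \<open>g @ f\<close> to \<open>q\<close>, which is the direct
      case; \<open>f\<close> then rebuilds \<open>w\<close>.\<close>
    define g where "g = drop (length f) ?D"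
    have take: "take n (alt_word y z m) = alt_word y z n" if "n \<le> m" for n m and y z :: gen
      using that
    proof (induction n arbitrary: m y z)
      case (Suc n)
      then show ?case by (cases m) auto
    qed simp
    have split: "?D = f @ g"
      unfolding g_def using take[of "length f" "2 * k" x "other x"] f_alt len
      by (metis append_take_drop_id less_imp_le)
    have g: "g \<noteq> []" "last g = other x" "alternating g" "last f \<noteq> hd g" "length f + length g = 2 * k"
      using len D last f unfolding g_def[symmetric] split
      by (auto simp: successively_append_iff g_def)
    have "alternating (g @ f)"
      using g f \<open>hd f = x\<close> by (auto simp: successively_append_iff)
    moreover have "reduced q"
      using assms w reduced_appendD by blast
    ultimately have "foldr act (pos_word (g @ f)) (q, j) = (q, j + 1)"
      using g f by (intro collapse) auto
    moreover have "foldr act (pos_word f) (q, j) = (w, j)" for j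
      using foldr_act_reduced[of f q j] assms w by simp
    ultimately show ?thesis
      using split by (simp add: pos_word_append)
  qed
qed

text \<open>Both sides of the relation raise the exponent by one, and inverse pairs cancel on
  reduced words, a property that every letter preserves. So the group acts on the normal
  forms.\<close>

lemma foldr_act_invariant:
  assumes "pres_eq (dihedral_rel (2 * k)) u v" "reduced w"
  shows "foldr act u (w, j) = foldr act v (w, j)"
proof -
  have red: "reduced (fst (foldr act u wj))" if "reduced (fst wj)" for u wj
    using that by (induction u) (use reduced_act in \<open>auto, metis prod.collapse\<close>)
  have "\<forall>wj. reduced (fst wj) \<longrightarrow> foldr act u wj = foldr act v wj"
    using assms(1)
  proof (induction rule: pres_eq.induct)
    case (rel u v)
    then show ?case
      using foldr_act_delta[of _ S] foldr_act_delta[of _ T] by (auto simp: dihedral_rel_def)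
  next
    case (cancel x b)
    then show ?case using act_cancel by auto
  next
    case (append u u' v v')
    then show ?case using red by (metis foldr_append comp_apply)
  qed auto
  with assms(2) show ?thesis by simp
qed

text \<open>A positive letter never lowers the exponent, and while the exponent stays 0, letters are
  only prepended.\<close>

lemma foldr_act_pos_word:
  "foldr act (pos_word v) ([], 0) = (c, j) \<Longrightarrow> j \<ge> 0 \<and> (j = 0 \<longrightarrow> c = v)"
proof (induction v arbitrary: c j)
  case Nil
  then show ?case by (simp add: pos_word_def)
next
  case (Cons x v)
  obtain c' j' where c': "foldr act (pos_word v) ([], 0) = (c', j')" by fastforce
  then have "act (x, True) (c', j') = (c, j)"
    using Cons.prems by (simp add: pos_word_def)
  with Cons.IH[OF c'] show ?case
    by (cases "reduced (x # c')") auto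
qed

end

section \<open>Depth and the Garside structure\<close>

lemma (in group) list_mult_append_single:
  "set xs \<subseteq> carrier G \<Longrightarrow> x \<in> carrier G \<Longrightarrow> list_mult G (xs @ [x]) = list_mult G xs \<otimes> x"
proof -
  have "foldr (\<otimes>) xs x = foldr (\<otimes>) xs \<one> \<otimes> x \<and> foldr (\<otimes>) xs \<one> \<in> carrier G"
    if "set xs \<subseteq> carrier G" "x \<in> carrier G"
    using that by (induction xs) (auto simp: m_assoc)
  then show "set xs \<subseteq> carrier G \<Longrightarrow> x \<in> carrier G \<Longrightarrow>
      list_mult G (xs @ [x]) = list_mult G xs \<otimes> x"
    by (simp add: list_mult_def)
qed

lemma (in group) list_mult_closed: "set xs \<subseteq> carrier G \<Longrightarrow> list_mult G xs \<in> carrier G"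
  unfolding list_mult_def by (induction xs) auto

text \<open>Factors are listed from the right, so removing the head of the list divides by the
  rightmost factor and exchanges the roles of \<open>N\<close> and \<open>M\<^sub>1\<close>. A
  single factor is also the last one and must be nontrivial.\<close>

lemma (in group) alt_decomp_Cons:
  assumes "M \<subseteq> carrier G"
  shows "alt_decomp G M N M\<^sub>1 a (y # ys) \<longleftrightarrow>
    y \<in> M \<and> set ys \<subseteq> M \<and> a = list_mult G (rev ys) \<otimes> y \<and> y = tail G M M\<^sub>1 a \<and>
    (if ys = [] then y \<noteq> \<one> else alt_decomp G M M\<^sub>1 N (list_mult G (rev ys)) ys)"
proof (cases "set (y # ys) \<subseteq> M")
  case True
  then have "list_mult G (rev ys @ [y]) = list_mult G (rev ys) \<otimes> y"
    using assms by (intro list_mult_append_single) auto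
  moreover have "(if even (Suc i) then M\<^sub>1 else N) = (if even i then N else M\<^sub>1)" for i
    by simp
  ultimately show ?thesis
    using True by (auto simp: alt_decomp_def All_less_Suc2 simp del: even_Suc)
qed (auto simp: alt_decomp_def)

text \<open>With trivial tails every factor would be 1, against the condition on the last
  one.\<close>

lemma (in group) alt_decomp_one:
  assumes "M \<subseteq> carrier G" "tail G M N \<one> = \<one>" "tail G M M\<^sub>1 \<one> = \<one>"
  shows "\<not> alt_decomp G M N M\<^sub>1 \<one> xs"
  using assms(2,3)
proof (induction xs arbitrary: N M\<^sub>1)
  case (Cons y ys)
  show ?case
  proof
    assume "alt_decomp G M N M\<^sub>1 \<one> (y # ys)"
    note dec = this[unfolded alt_decomp_Cons[OF assms(1)]]
    have y: "y = \<one>"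
      using dec Cons.prems(2) by (metis (no_types))
    have ys: "set (rev ys) \<subseteq> carrier G"
      using dec assms(1) by (metis set_rev subset_trans)
    have "list_mult G (rev ys) = list_mult G (rev ys) \<otimes> y"
      using list_mult_closed[OF ys] y by simp
    then have "list_mult G (rev ys) = \<one>"
      using dec by (metis (no_types))
    with dec y have "alt_decomp G M M\<^sub>1 N \<one> ys"
      by (metis (no_types, lifting))
    with Cons.IH[of M\<^sub>1 N] Cons.prems show False by blast
  qed
qed (simp add: alt_decomp_def)

text \<open>The rightmost factor is forced to be the tail of \<open>a\<close>; cancelling it leaves
  equal quotients, to which induction applies with \<open>N\<close> and \<open>M\<^sub>1\<close>
  exchanged.\<close>

lemma (in group) alt_decomp_unique:
  assumes "M \<subseteq> carrier G" "tail G M N \<one> = \<one>" "tail G M M\<^sub>1 \<one> = \<one>"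
    and "alt_decomp G M N M\<^sub>1 a xs" "alt_decomp G M N M\<^sub>1 a ys"
  shows "xs = ys"
  using assms(2-)
proof (induction xs arbitrary: N M\<^sub>1 a ys)
  case Nil
  then show ?case by (simp add: alt_decomp_def)
next
  case (Cons x xs)
  obtain y ys' where ys: "ys = y # ys'"
    using Cons.prems(4) by (cases ys) (auto simp: alt_decomp_def)
  note x_dec = Cons.prems(3)[unfolded alt_decomp_Cons[OF assms(1)]]
  note y_dec = Cons.prems(4)[unfolded ys alt_decomp_Cons[OF assms(1)]]
  have hd: "x = y"
    using x_dec y_dec by (metis (no_types))
  have closed: "y \<in> carrier G" "set (rev xs) \<subseteq> carrier G" "set (rev ys') \<subseteq> carrier G"
    using x_dec y_dec assms(1) by (metis subsetD, metis set_rev subset_trans, metis set_rev subset_trans)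
  have "list_mult G (rev xs) \<otimes> y = list_mult G (rev ys') \<otimes> y"
    using x_dec y_dec hd by (metis (no_types))
  then have eq: "list_mult G (rev xs) = list_mult G (rev ys')"
    using closed list_mult_closed by (metis r_cancel)
  note xs = x_dec[THEN conjunct2, THEN conjunct2, THEN conjunct2, THEN conjunct2]
    and ys' = y_dec[THEN conjunct2, THEN conjunct2, THEN conjunct2, THEN conjunct2]
  have one: "\<not> alt_decomp G M M\<^sub>1 N (list_mult G []) zs" for zs
    using alt_decomp_one[OF assms(1) Cons.prems(2,1)] by (simp add: list_mult_def)
  have "xs = ys'"
  proof (cases "xs = [] \<or> ys' = []")
    \<comment> \<open>If one list ends here, the common quotient is 1, which has no decomposition,
      so the other list ends too.\<close>
    case True
    with xs ys' eq one show ?thesis by (metis rev.simps(1))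
  next
    case False
    with xs ys' eq Cons.IH[of M\<^sub>1 N] Cons.prems(1,2) show ?thesis by simp
  qed
  with hd ys show ?case by simp
qed

section \<open>The Artin group: \<open>\<Delta>\<close>, normal forms and unmovable elements\<close>

context dihedral
begin

abbreviation artin :: "gen sword set monoid" where
  "artin \<equiv> dihedral_artin (2 * k)"

sublocale group artin
  unfolding dihedral_artin_def by (rule group_presented_group)

definition el :: "gen list \<Rightarrow> gen sword set" where
  "el w = pres_class (dihedral_rel (2 * k)) (pos_word w)"

definition delta :: "gen sword set" where
  "delta = el (alt_word S T (2 * k))"

abbreviation positive :: "gen sword set set" where
  "positive \<equiv> submonoid_generated artin {el [S], el [T]}"

abbreviation powers :: "gen \<Rightarrow> gen sword set set" where
  "powers x \<equiv> submonoid_generated artin {el [x]}"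

lemma el_closed [simp]: "el w \<in> carrier artin"
  by (simp add: el_def dihedral_artin_def presented_group_def)

lemma el_mult: "el u \<otimes>\<^bsub>artin\<^esub> el v = el (u @ v)"
  by (simp add: el_def dihedral_artin_def mult_presented_group pos_word_append)

lemma el_Nil: "el [] = \<one>\<^bsub>artin\<^esub>"
  by (simp add: el_def dihedral_artin_def presented_group_def pos_word_def)

lemma delta_closed [simp]: "delta \<in> carrier artin"
  by (simp add: delta_def)

lemma el_eq_imp_act:
  "el u = el v \<Longrightarrow> foldr act (pos_word u) ([], 0) = foldr act (pos_word v) ([], 0)"
  by (intro foldr_act_invariant) (auto simp: el_def pres_class_eq_iff)

lemma el_alternating:
  assumes "alternating f" "length f = 2 * k"
  shows "el f = delta"
proof -
  obtain x f' where f: "f = x # f'"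
    using assms k_ge_2 by (cases f) auto
  then have "f = alt_word x (other x) (2 * k)"
    using alternating_eq_alt_word[of x f'] assms by (metis length_Cons)
  moreover have "el (alt_word S T (2 * k)) = el (alt_word T S (2 * k))"
    unfolding el_def pres_class_eq_iff by (intro pres_eq.rel) (simp add: dihedral_rel_def)
  ultimately show ?thesis by (cases x) (auto simp: delta_def)
qed

text \<open>Putting \<open>x\<close> before the alternating word that starts with the other letter
  gives an alternating word of length \<open>2 * k + 1\<close>, whose first and last
  \<open>2 * k\<close> letters both spell \<open>\<Delta>\<close>.\<close>

lemma delta_central: "delta \<otimes>\<^bsub>artin\<^esub> el w = el w \<otimes>\<^bsub>artin\<^esub> delta"
proof (induction w)
  case (Cons x w)
  have alt: "el (alt_word y (other y) (2 * k)) = delta" for y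
    using alternating_alt_word by (intro el_alternating) auto
  have "el [x] \<otimes>\<^bsub>artin\<^esub> delta = delta \<otimes>\<^bsub>artin\<^esub> el [x]"
    using Cons_alt_word_even[of x k] alt[of x] alt[of "other x"]
      el_mult[of "[x]" "alt_word (other x) x (2 * k)"] el_mult[of "alt_word x (other x) (2 * k)" "[x]"]
    by simp
  moreover have "el (x # w) = el [x] \<otimes>\<^bsub>artin\<^esub> el w"
    by (simp add: el_mult)
  ultimately show ?case
    using Cons by (metis m_assoc el_closed delta_closed)
qed (simp add: el_Nil)

lemma delta_pow: "delta [^]\<^bsub>artin\<^esub> n = el (concat (replicate n (alt_word S T (2 * k))))"
  for n :: nat
proof (induction n)
  case (Suc n)
  have "delta [^]\<^bsub>artin\<^esub> Suc n = delta \<otimes>\<^bsub>artin\<^esub> delta [^]\<^bsub>artin\<^esub> n"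
    by (intro nat_pow_Suc2) simp
  with Suc show ?case by (simp add: el_mult delta_def)
qed (simp add: el_Nil)

lemma collapses_el: "collapses w c p \<Longrightarrow> el w = el c \<otimes>\<^bsub>artin\<^esub> delta [^]\<^bsub>artin\<^esub> p"
proof (induction rule: collapses.induct)
  case (step f u v c p)
  have "el (u @ f @ v) = el u \<otimes>\<^bsub>artin\<^esub> (el f \<otimes>\<^bsub>artin\<^esub> el v)"
    by (simp add: el_mult)
  also have "\<dots> = el u \<otimes>\<^bsub>artin\<^esub> (el v \<otimes>\<^bsub>artin\<^esub> delta)"
    using el_alternating[OF step.hyps(1,2)] delta_central by simp
  also have "\<dots> = el (u @ v) \<otimes>\<^bsub>artin\<^esub> delta"
    by (simp add: m_assoc[symmetric] el_mult)
  also have "\<dots> = el c \<otimes>\<^bsub>artin\<^esub> delta [^]\<^bsub>artin\<^esub> Suc p"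
    using step.IH by (simp add: m_assoc)
  finally show ?case .
qed simp

lemma el_eq_reduced_delta:
  assumes "reduced w" "el v = el w \<otimes>\<^bsub>artin\<^esub> delta [^]\<^bsub>artin\<^esub> (n :: nat)"
  shows "foldr act (pos_word v) ([], 0) = (w, int n)"
proof -
  have pow: "foldr act (pos_word (concat (replicate n (alt_word S T (2 * k))))) ([], 0) = ([], int n)"
    for n
    using foldr_act_delta[of "[]" S] by (induction n) (auto simp: pos_word_append, simp add: pos_word_def)
  have "el v = el (w @ concat (replicate n (alt_word S T (2 * k))))"
    using assms(2) by (simp add: delta_pow el_mult)
  then have "foldr act (pos_word v) ([], 0) =
      foldr act (pos_word (w @ concat (replicate n (alt_word S T (2 * k))))) ([], 0)"
    by (rule el_eq_imp_act)
  with pow[of n] foldr_act_reduced[of w "[]" "int n"] assms(1) show ?thesis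
    by (simp add: pos_word_append)
qed

text \<open>Here \<open>v\<close> ranges over all positive words: acting on \<open>([], 0)\<close>
  it reaches exponent 0, which rules out any drop, so it is its own normal form.\<close>

lemma el_eq_reducedD: "reduced w \<Longrightarrow> el v = el w \<Longrightarrow> v = w"
  using el_eq_reduced_delta[of w v 0] foldr_act_pos_word[of v w 0] by simp

lemma delta_form_unique:
  assumes "reduced a" "reduced b"
    and "el a \<otimes>\<^bsub>artin\<^esub> delta [^]\<^bsub>artin\<^esub> (i :: int) = el b \<otimes>\<^bsub>artin\<^esub> delta [^]\<^bsub>artin\<^esub> (j :: int)"
  shows "a = b \<and> i = j"
proof -
  have "a = b \<and> i = j" if "i \<le> j" and red: "reduced a" "reduced b"
    and eq: "el a \<otimes>\<^bsub>artin\<^esub> delta [^]\<^bsub>artin\<^esub> i = el b \<otimes>\<^bsub>artin\<^esub> delta [^]\<^bsub>artin\<^esub> j"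
    for a b and i j :: int
  proof -
    \<comment> \<open>Cancelling \<open>\<Delta>^i\<close> leaves a natural power of
      \<open>\<Delta>\<close> on one side, so that both sides are represented by positive
      words.\<close>
    obtain n where n: "j = int n + i"
      using \<open>i \<le> j\<close> by (metis zle_iff_zadd add.commute)
    have "el b \<otimes>\<^bsub>artin\<^esub> delta [^]\<^bsub>artin\<^esub> j =
        (el b \<otimes>\<^bsub>artin\<^esub> delta [^]\<^bsub>artin\<^esub> n) \<otimes>\<^bsub>artin\<^esub> delta [^]\<^bsub>artin\<^esub> i"
      by (simp add: n int_pow_mult m_assoc int_pow_int)
    then have "el a = el b \<otimes>\<^bsub>artin\<^esub> delta [^]\<^bsub>artin\<^esub> n"
      using eq by simp
    then have "foldr act (pos_word a) ([], 0) = (b, int n)"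
      by (rule el_eq_reduced_delta[OF red(2)])
    moreover have "foldr act (pos_word a) ([], 0) = (a, 0)"
      using foldr_act_reduced[of a "[]"] red by simp
    ultimately show ?thesis using n by simp
  qed
  from this[of i j a b] this[of j i b a] assms show ?thesis by fastforce
qed

lemma positive_eq: "positive = range el"
proof
  show "positive \<subseteq> range el"
  proof
    fix x assume "x \<in> positive"
    then show "x \<in> range el"
      by induction (auto simp: el_mult simp flip: el_Nil)
  qed
  have "el w \<in> positive" for w
  proof (induction w)
    case (Cons x w)
    then have "el [x] \<otimes>\<^bsub>artin\<^esub> el w \<in> positive"
      by (cases x) (auto intro: submonoid_generated.intros)
    then show ?case by (simp add: el_mult)
  qed (auto simp: el_Nil intro: submonoid_generated.intros)
  then show "range el \<subseteq> positive" by auto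
qed

lemma positive_mem: "el w \<in> positive"
  by (simp add: positive_eq)

lemma powers_eq: "powers x = range (\<lambda>i. el (replicate i x))"
proof
  show "powers x \<subseteq> range (\<lambda>i. el (replicate i x))"
  proof
    fix y assume "y \<in> powers x"
    then show "y \<in> range (\<lambda>i. el (replicate i x))"
    proof induction
      case one
      then show ?case using el_Nil by (intro image_eqI[of _ _ 0]) auto
    next
      case (incl y)
      then show ?case by (intro image_eqI[of _ _ 1]) auto
    next
      case (mult y z)
      then obtain i j where "y = el (replicate i x)" "z = el (replicate j x)" by auto
      then show ?case
        by (intro image_eqI[of _ _ "i + j"]) (auto simp: el_mult replicate_add)
    qed
  qed
  have "el (replicate i x) \<in> powers x" for i
  proof (induction i)
    case (Suc i)
    then have "el [x] \<otimes>\<^bsub>artin\<^esub> el (replicate i x) \<in> powers x"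
      by (auto intro: submonoid_generated.intros)
    then show ?case by (simp add: el_mult)
  qed (auto simp: el_Nil intro: submonoid_generated.intros)
  then show "range (\<lambda>i. el (replicate i x)) \<subseteq> powers x" by auto
qed

lemma positive_closed: "positive \<subseteq> carrier artin"
  by (auto simp: positive_eq)

lemma le_R_el: "le_R artin positive (el u) (el w) \<longleftrightarrow> (\<exists>v. el w = el (v @ u))"
proof
  assume "le_R artin positive (el u) (el w)"
  then obtain v where "el w \<otimes>\<^bsub>artin\<^esub> inv\<^bsub>artin\<^esub> el u = el v"
    by (auto simp: le_R_def positive_eq)
  then have "el w = el v \<otimes>\<^bsub>artin\<^esub> el u"
    by (metis inv_solve_right el_closed)
  then show "\<exists>v. el w = el (v @ u)" by (auto simp: el_mult)
next
  assume "\<exists>v. el w = el (v @ u)"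
  then obtain v where "el w = el v \<otimes>\<^bsub>artin\<^esub> el u" by (auto simp: el_mult)
  then have "el w \<otimes>\<^bsub>artin\<^esub> inv\<^bsub>artin\<^esub> el u = el v"
    by (metis inv_solve_right el_closed)
  then show "le_R artin positive (el u) (el w)" by (auto simp: le_R_def positive_eq)
qed

lemma not_reduced_append_delta: "\<not> reduced (v @ alt_word S T (2 * k))"
  using alternating_alt_word[of S "2 * k"] unfolding reduced_def
  by (metis length_alt_word other.simps(1) sublist_append_leftI)

text \<open>A forbidden factor equals \<open>\<Delta>\<close> and can be moved to the right end.
  Conversely, a reduced word is the only positive word for its element, so if
  \<open>\<Delta>\<close> divided it, it would end in the word of \<open>\<Delta>\<close>.\<close>

lemma unmovable_iff: "unmovable artin positive delta a \<longleftrightarrow> (\<exists>w. reduced w \<and> a = el w)"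
proof
  assume a: "unmovable artin positive delta a"
  then obtain w where w: "a = el w" by (auto simp: unmovable_def positive_eq)
  have "reduced w"
  proof (rule ccontr)
    assume "\<not> reduced w"
    then obtain u f v where "w = u @ f @ v" "alternating f" "length f = 2 * k"
      by (auto simp: reduced_def sublist_def)
    then have "el w = el ((u @ v) @ alt_word S T (2 * k))"
      using collapses_el[OF collapses.step[OF _ _ collapses.base]]
      by (simp add: delta_def el_mult)
    then have "le_R artin positive delta a"
      unfolding w delta_def le_R_el by blast
    with a show False by (simp add: unmovable_def)
  qed
  with w show "\<exists>w. reduced w \<and> a = el w" by blast
next
  assume "\<exists>w. reduced w \<and> a = el w"
  then obtain w where w: "reduced w" "a = el w" by blast
  have "\<not> le_R artin positive delta (el w)"
  proof
    assume "le_R artin positive delta (el w)"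
    then obtain v where "el w = el (v @ alt_word S T (2 * k))"
      unfolding delta_def le_R_el by blast
    then show False
      using el_eq_reducedD[OF w(1)] w(1) not_reduced_append_delta by metis
  qed
  with w show "unmovable artin positive delta a"
    by (auto simp: unmovable_def positive_eq)
qed

lemma delta_form_el:
  assumes "reduced c"
  shows "delta_form artin positive delta (el c \<otimes>\<^bsub>artin\<^esub> delta [^]\<^bsub>artin\<^esub> (p :: nat)) = (el c, int p)"
  unfolding delta_form_def
proof (rule the_equality)
  show "case (el c, int p) of (a, j) \<Rightarrow> unmovable artin positive delta a \<and>
      el c \<otimes>\<^bsub>artin\<^esub> delta [^]\<^bsub>artin\<^esub> p = a \<otimes>\<^bsub>artin\<^esub> delta [^]\<^bsub>artin\<^esub> j"
    using assms by (auto simp: unmovable_iff int_pow_int)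
next
  fix x :: "gen sword set \<times> int"
  assume "case x of (a, j) \<Rightarrow> unmovable artin positive delta a \<and>
      el c \<otimes>\<^bsub>artin\<^esub> delta [^]\<^bsub>artin\<^esub> p = a \<otimes>\<^bsub>artin\<^esub> delta [^]\<^bsub>artin\<^esub> j"
  then obtain w j where w: "x = (el w, j)" "reduced w"
    "el c \<otimes>\<^bsub>artin\<^esub> delta [^]\<^bsub>artin\<^esub> int p = el w \<otimes>\<^bsub>artin\<^esub> delta [^]\<^bsub>artin\<^esub> j"
    by (auto simp: unmovable_iff int_pow_int split: prod.splits)
  with delta_form_unique[OF assms w(2,3)] show "x = (el c, int p)" by simp
qed

section \<open>Tails, alternating decompositions and depth\<close>

lemma el_replicate_eq_iff: "el (replicate i x) = el (replicate j x) \<longleftrightarrow> i = j"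
  using el_eq_reducedD[OF reduced_replicate, of "replicate i x" j x]
  by (auto dest: arg_cong[of _ _ length])

text \<open>If \<open>x^j\<close> with \<open>j > i\<close> divided the element, cancelling
  \<open>x^i\<close> would make \<open>w\<close> equal, letter by letter, to a word ending in
  \<open>x\<close>.\<close>

lemma powers_below:
  assumes "reduced w" "w = [] \<or> last w \<noteq> x"
  shows "{c \<in> powers x. le_R artin positive c (el (w @ replicate i x))} =
    (\<lambda>j. el (replicate j x)) ` {..i}"
proof -
  have "(\<exists>v. el (w @ replicate i x) = el (v @ replicate j x)) \<longleftrightarrow> j \<le> i" for j
  proof
    assume "\<exists>v. el (w @ replicate i x) = el (v @ replicate j x)"
    then obtain v where v: "el (w @ replicate i x) = el (v @ replicate j x)" by blast
    show "j \<le> i"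
    proof (rule ccontr)
      assume "\<not> j \<le> i"
      then have "replicate j x = replicate (j - i) x @ replicate i x"
        by (simp flip: replicate_add)
      then have "el w \<otimes>\<^bsub>artin\<^esub> el (replicate i x) =
          el (v @ replicate (j - i) x) \<otimes>\<^bsub>artin\<^esub> el (replicate i x)"
        using v by (simp add: el_mult)
      then have "v @ replicate (j - i) x = w"
        using el_eq_reducedD[OF assms(1)] by (metis r_cancel el_closed)
      moreover have "last (v @ replicate (j - i) x) = x" "v @ replicate (j - i) x \<noteq> []"
        using \<open>\<not> j \<le> i\<close> by auto
      ultimately show False using assms(2) by auto
    qed
  next
    assume "j \<le> i"
    then have "w @ replicate i x = (w @ replicate (i - j) x) @ replicate j x"
      by (simp flip: replicate_add)
    then show "\<exists>v. el (w @ replicate i x) = el (v @ replicate j x)" by metis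
  qed
  then show ?thesis by (auto simp: powers_eq le_R_el)
qed

lemma tail_el:
  assumes "reduced w" "w = [] \<or> last w \<noteq> x"
  shows "tail artin positive (powers x) (el (w @ replicate i x)) = el (replicate i x)"
  unfolding tail_def powers_below[OF assms]
proof (rule the_equality)
  show "el (replicate i x) \<in> powers x \<and> (\<lambda>j. el (replicate j x)) ` {..i} =
      {c \<in> powers x. le_R artin positive c (el (replicate i x))}"
    using powers_below[of "[]" x i] by (auto simp: powers_eq)
next
  fix b
  assume b: "b \<in> powers x \<and> (\<lambda>j. el (replicate j x)) ` {..i} =
      {c \<in> powers x. le_R artin positive c b}"
  then obtain n where n: "b = el (replicate n x)" by (auto simp: powers_eq)
  have "(\<lambda>j. el (replicate j x)) ` {..i} = (\<lambda>j. el (replicate j x)) ` {..n}"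
    using b n powers_below[of "[]" x n] by simp
  moreover have "inj (\<lambda>j. el (replicate j x))"
    by (auto simp: inj_def el_replicate_eq_iff)
  ultimately have "{..i} = {..n}"
    by (simp add: inj_image_eq_iff)
  with n show "b = el (replicate i x)" by simp
qed

text \<open>The factors are the maximal runs of letters, read from the right. The induction strips
  the trailing run and exchanges \<open>x\<close> with the other letter. For \<open>i = 0\<close>
  the first factor is 1, just as \<open>runs_after\<close> counts an empty first run.\<close>

lemma alt_decomp_el:
  assumes "reduced w" "w = [] \<or> last w \<noteq> x" "w @ replicate i x \<noteq> []"
  shows "\<exists>xs. alt_decomp artin positive (powers (other x)) (powers x) (el (w @ replicate i x)) xs \<and>
    length xs = runs_after x (rev (w @ replicate i x))"
  using assms
proof (induction "length w" arbitrary: w x i rule: less_induct)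
  case less
  note tail = tail_el[OF less.prems(1,2), of i]
  show ?case
  proof (cases "w = []")
    case True
    with less.prems have "el (replicate i x) \<noteq> el []"
      using el_replicate_eq_iff[of i x 0] by auto
    moreover have "el (replicate i x) \<in> positive"
      by (simp add: positive_eq)
    ultimately have "alt_decomp artin positive (powers (other x)) (powers x)
        (el (w @ replicate i x)) [el (replicate i x)]"
      unfolding alt_decomp_Cons[OF positive_closed]
      using True tail by (simp add: list_mult_def el_Nil)
    moreover have "runs_after x (rev (w @ replicate i x)) = 1"
      using True runs_after_replicate[of x i "[]"] by simp
    ultimately show ?thesis by (intro exI[of _ "[el (replicate i x)]"]) simp
  next
    case False
    obtain v n where v: "w = v @ replicate n (other x)" "v = [] \<or> last v \<noteq> other x"
      by (rule trailing_runE)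
    have "n > 0"
      using v False less.prems(2) by (cases n) (auto simp: neq_iff_other)
    moreover have "reduced v"
      using v less.prems(1) reduced_appendD by blast
    ultimately obtain xs where xs: "alt_decomp artin positive (powers x) (powers (other x)) (el w) xs"
      "length xs = runs_after (other x) (rev w)"
      using less.hyps[of v "other x" n] v False by auto
    have dec: "xs \<noteq> []" "set xs \<subseteq> positive" "list_mult artin (rev xs) = el w"
      using xs(1) by (auto simp: alt_decomp_def)
    have "alt_decomp artin positive (powers (other x)) (powers x)
        (el (w @ replicate i x)) (el (replicate i x) # xs)"
      unfolding alt_decomp_Cons[OF positive_closed]
      using dec xs(1) tail by (simp add: el_mult positive_mem)
    moreover have "runs_after x (rev (w @ replicate i x)) = Suc (runs_after (other x) (rev w))"
    proof -
      obtain n' where "n = Suc n'" using \<open>n > 0\<close> by (cases n) auto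
      then show ?thesis
        using v by (simp add: runs_after_replicate replicate_append_same)
    qed
    ultimately show ?thesis using xs(2) by (intro exI[of _ "el (replicate i x) # xs"]) simp
  qed
qed

text \<open>Powers of \<open>t\<close> are allowed after the reduced word because Condition A
  concerns the movable elements \<open>\<Delta>^j = \<theta>^j t^j\<close>.\<close>

lemma dpt_el:
  assumes "reduced w" "w = [] \<or> last w = S"
  shows "dpt artin positive (powers S) (powers T) (el (w @ replicate i T)) =
    s_blocks (w @ replicate i T)"
proof -
  let ?w = "w @ replicate i T"
  have tail_one: "tail artin positive (powers x) \<one>\<^bsub>artin\<^esub> = \<one>\<^bsub>artin\<^esub>" for x
    using tail_el[of "[]" x 0] by (simp add: el_Nil)
  have "bh artin positive (powers S) (powers T) (el ?w) = runs_after T (rev ?w)"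
  proof (cases "?w = []")
    case True
    then show ?thesis by (simp add: bh_def el_Nil)
  next
    case False
    have "el ?w \<noteq> \<one>\<^bsub>artin\<^esub>"
      using el_eq_reducedD[of "[]" ?w] False el_Nil by auto
    moreover obtain xs where xs: "alt_decomp artin positive (powers S) (powers T) (el ?w) xs"
      "length xs = runs_after T (rev ?w)"
      using alt_decomp_el[of w T i] assms False by auto
    moreover have "(THE xs. alt_decomp artin positive (powers S) (powers T) (el ?w) xs) = xs"
      using xs(1) alt_decomp_unique[OF positive_closed tail_one tail_one]
      by (intro the_equality) auto
    ultimately show ?thesis by (simp add: bh_def)
  qed
  then have "dpt artin positive (powers S) (powers T) (el ?w) = runs_after T (rev ?w) div 2"
    by (auto simp: dpt_def elim: oddE)
  then show ?thesis
    by (simp only: runs_after_s_blocks s_blocks_rev)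
qed

lemma dpt_reduced:
  assumes "reduced w"
  shows "dpt artin positive (powers S) (powers T) (el w) = s_blocks w"
proof -
  obtain v i where v: "w = v @ replicate i T" "v = [] \<or> last v \<noteq> T"
    by (rule trailing_runE)
  moreover have "reduced v"
    using v assms reduced_appendD by blast
  moreover have "v = [] \<or> last v = S"
    using v(2) neq_iff_other[of "last v" T] by (cases "last v") auto
  ultimately show ?thesis using dpt_el by blast
qed

section \<open>The element \<open>\<theta>\<close> and the two conditions\<close>

definition theta :: "gen sword set" where
  "theta = delta \<otimes>\<^bsub>artin\<^esub> inv\<^bsub>artin\<^esub> el [T]"

lemma theta_eq: "theta = el (alt_word S T (2 * k - 1))"
proof -
  have "delta = el (alt_word S T (2 * k - 1)) \<otimes>\<^bsub>artin\<^esub> el [T]"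
    using el_alternating[OF alternating_theta_T] by (simp add: el_mult)
  then show ?thesis by (simp add: theta_def m_assoc)
qed

lemma theta_pow: "theta [^]\<^bsub>artin\<^esub> (j :: nat) = el (theta_word j)"
proof (induction j)
  case (Suc j)
  then show ?case by (simp add: theta_eq el_mult theta_word_Suc')
qed (simp add: el_Nil)

lemma condition_A_dihedral:
  assumes "posmon P = powers S" "posmon Q = powers T"
  shows "condition_A artin positive delta P Q (k - 1)"
  unfolding condition_A_def assms
proof (intro allI impI)
  fix j :: nat assume "j \<ge> 1"
  have "el [T] [^]\<^bsub>artin\<^esub> j = el (replicate j T)"
    by (induction j) (auto simp: el_Nil el_mult replicate_append_same)
  moreover have "theta \<otimes>\<^bsub>artin\<^esub> el [T] = delta"
    by (simp add: theta_def m_assoc)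
  \<comment> \<open>\<open>\<theta>\<close> commutes with \<open>t\<close> because
    \<open>\<Delta>\<close> is central; this splits \<open>\<Delta>^j\<close> into
    \<open>\<theta>^j t^j\<close>.\<close>
  moreover have "theta \<otimes>\<^bsub>artin\<^esub> el [T] = el [T] \<otimes>\<^bsub>artin\<^esub> theta"
  proof -
    have "el [T] \<otimes>\<^bsub>artin\<^esub> theta = (el [T] \<otimes>\<^bsub>artin\<^esub> delta) \<otimes>\<^bsub>artin\<^esub> inv\<^bsub>artin\<^esub> el [T]"
      by (simp add: theta_def m_assoc)
    also have "\<dots> = delta"
      by (simp add: m_assoc flip: delta_central)
    finally show ?thesis by (simp add: theta_def m_assoc)
  qed
  ultimately have "delta [^]\<^bsub>artin\<^esub> j = el (theta_word j @ replicate j T)"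
    using pow_mult_distrib[of theta "el [T]" j] theta_pow[of j]
    by (simp add: theta_eq el_mult)
  moreover have "s_blocks (replicate j T) = 0"
    by (rule s_blocks_only_T) auto
  then have "s_blocks (theta_word j @ replicate j T) = (k - 1) * j + 1"
    using s_blocks_append[of "theta_word j" "replicate j T"] s_blocks_theta_word[of j] \<open>j \<ge> 1\<close>
    by (cases j) auto
  ultimately show "dpt artin positive (powers S) (powers T) (delta [^]\<^bsub>artin\<^esub> j) = (k - 1) * j + 1"
    using dpt_el[of "theta_word j" j] reduced_theta_word last_theta_word[of j] \<open>j \<ge> 1\<close> by simp
qed

lemma el_mem_powers_T:
  assumes "reduced w"
  shows "el w \<in> powers T \<longleftrightarrow> set w \<subseteq> {T}"
proof
  assume "el w \<in> powers T"
  then obtain i where "el (replicate i T) = el w" by (auto simp: powers_eq)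
  then have "w = replicate i T"
    using el_eq_reducedD[OF assms] by blast
  then show "set w \<subseteq> {T}" by auto
next
  assume "set w \<subseteq> {T}"
  then have "w = replicate (length w) T"
    by (metis replicate_length_same singletonD subsetD)
  then show "el w \<in> powers T" unfolding powers_eq by (metis rangeI)
qed

text \<open>For \<open>i > 0\<close> the element \<open>\<theta>\<^sup>j t\<^sup>i\<close> is movable, because \<open>\<theta> t = \<Delta>\<close>.\<close>

lemma el_mem_Theta:
  assumes "reduced w" "garside Q = el [T]" "posmon Q = powers T"
  shows "el w \<in> Theta artin delta Q \<longleftrightarrow> (\<exists>j>0. w = theta_word j)"
proof
  assume "el w \<in> Theta artin delta Q"
  then obtain j :: nat and i where j: "j > 0" "el w = theta [^]\<^bsub>artin\<^esub> j \<otimes>\<^bsub>artin\<^esub> el (replicate i T)"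
    unfolding Theta_def assms(2,3) theta_def[symmetric] powers_eq by (auto simp: Suc_le_eq)
  then have w: "w = theta_word j @ replicate i T"
    using el_eq_reducedD[OF assms(1), of "theta_word j @ replicate i T"]
    by (simp add: theta_pow el_mult)
  have "i = 0"
  proof (rule ccontr)
    assume "i \<noteq> 0"
    then obtain i' j' where "i = Suc i'" "j = Suc j'"
      using j(1) by (metis not0_implies_Suc less_numeral_extra(3))
    then have "w = theta_word j' @ (alt_word S T (2 * k - 1) @ [T]) @ replicate i' T"
      using w by (simp add: theta_word_Suc')
    then show False
      using assms(1) alternating_theta_T unfolding reduced_def by (metis sublist_appendI)
  qed
  with j w show "\<exists>j>0. w = theta_word j" by auto
next
  assume "\<exists>j>0. w = theta_word j"
  then obtain j :: nat where "j > 0" "el w = theta [^]\<^bsub>artin\<^esub> j \<otimes>\<^bsub>artin\<^esub> \<one>\<^bsub>artin\<^esub>"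
    by (auto simp: theta_pow)
  then show "el w \<in> Theta artin delta Q"
    unfolding Theta_def assms(2,3) theta_def[symmetric]
    by (auto simp: Suc_le_eq intro: submonoid_generated.one)
qed

lemma condition_B_dihedral:
  assumes P: "posmon P = powers S" and Q: "garside Q = el [T]" "posmon Q = powers T"
  shows "condition_B artin positive delta P Q (k - 1)"
proof -
  let ?d = "\<lambda>x. int (dpt artin positive (powers S) (powers T) x)"
  have main: "case delta_form artin positive delta (a \<otimes>\<^bsub>artin\<^esub> b) of (c, p) \<Rightarrow>
      \<exists>\<epsilon>\<in>{0, 1}. ?d c = ?d a + ?d b - int (k - 1) * p - \<epsilon> \<and>
      (a \<in> Theta artin delta Q \<or> b \<in> Theta artin delta Q \<or> c \<in> powers T \<longrightarrow> \<epsilon> = 1)"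
    if unmov: "unmovable artin positive delta a" "unmovable artin positive delta b"
      and not_both: "\<not> (a \<in> Theta_bar artin delta Q \<and> b \<in> Theta_bar artin delta Q)" for a b
  proof -
    obtain u v where u: "reduced u" "a = el u" and v: "reduced v" "b = el v"
      using unmov by (auto simp: unmovable_iff)
    note Theta = el_mem_Theta[OF u(1) Q] el_mem_Theta[OF v(1) Q]
    note powers_T = el_mem_powers_T[OF u(1)] el_mem_powers_T[OF v(1)]
    obtain c p e where c: "reduced c" "collapses (u @ v) c p" "e \<le> 1"
      "s_blocks c + (k - 1) * p + e = s_blocks u + s_blocks v"
      "a \<in> Theta artin delta Q \<or> b \<in> Theta artin delta Q \<or> set c \<subseteq> {T} \<longrightarrow> e = 1"
    proof (cases "a \<in> Theta artin delta Q \<or> b \<in> Theta artin delta Q")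
      \<comment> \<open>A factor in \<open>\<Theta>\<close> is some \<open>\<theta>^j\<close>, and
        the other factor is then not a power of \<open>t\<close>, as the pair lies outside the
        excluded set; the products with \<open>theta_word\<close> have defect exactly 1.\<close>
      case True
      then have "\<exists>c p. reduced c \<and> collapses (u @ v) c p \<and>
          s_blocks c + (k - 1) * p + 1 = s_blocks u + s_blocks v"
      proof
        assume "a \<in> Theta artin delta Q"
        moreover from this have "\<not> set v \<subseteq> {T}"
          using not_both powers_T v Q by (auto simp: Theta_bar_def)
        ultimately show ?thesis
          using theta_product_s_blocks[OF v(1)] Theta u by auto
      next
        assume "b \<in> Theta artin delta Q"
        moreover from this have "\<not> set u \<subseteq> {T}"
          using not_both powers_T u Q by (auto simp: Theta_bar_def)
        ultimately show ?thesis
          using product_theta_s_blocks[OF u(1)] Theta v by auto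
      qed
      then show thesis using that[of _ _ 1] by auto
    next
      case False
      \<comment> \<open>Not both words are powers of \<open>t\<close>, so the last clause of
        \<open>product_s_blocks\<close> gives defect 1 whenever \<open>c\<close> is one.\<close>
      have "\<not> (set u \<subseteq> {T} \<and> set v \<subseteq> {T})"
        using not_both powers_T u v Q by (auto simp: Theta_bar_def)
      with False product_s_blocks[OF u(1) v(1)] that show thesis by blast
    qed
    have "a \<otimes>\<^bsub>artin\<^esub> b = el c \<otimes>\<^bsub>artin\<^esub> delta [^]\<^bsub>artin\<^esub> p"
      using collapses_el[OF c(2)] u v by (simp add: el_mult)
    then have "delta_form artin positive delta (a \<otimes>\<^bsub>artin\<^esub> b) = (el c, int p)"
      using delta_form_el[OF c(1)] by simp
    moreover have "int (s_blocks c) = int (s_blocks u) + int (s_blocks v) - int (k - 1) * int p - int e"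
      using arg_cong[OF c(4), of int] by (simp only: of_nat_add of_nat_mult)
    ultimately show ?thesis
      using c(3,5) u v el_mem_powers_T[OF c(1)] dpt_reduced c(1)
      by (auto intro!: bexI[of _ "int e"])
  qed
  show ?thesis
    unfolding condition_B_def P Q(2) Let_def
  proof (rule ballI, rule case_prodI2, rule impI)
    fix x a b
    assume "x \<in> positive \<times> positive - Theta_bar artin delta Q \<times> Theta_bar artin delta Q"
      "x = (a, b)" "unmovable artin positive delta a \<and> unmovable artin positive delta b"
    then show "case delta_form artin positive delta (a \<otimes>\<^bsub>artin\<^esub> b) of (c, p) \<Rightarrow>
      \<exists>\<epsilon>\<in>{0, 1}. ?d c = ?d a + ?d b - int (k - 1) * p - \<epsilon> \<and>
      (a \<in> Theta artin delta Q \<or> b \<in> Theta artin delta Q \<or> c \<in> powers T \<longrightarrow> \<epsilon> = 1)"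
      by (intro main) simp_all
  qed
qed

lemma list_mult_el: "list_mult artin (map (\<lambda>x. el [x]) w) = el w"
  by (induction w) (auto simp: list_mult_def el_Nil el_mult)

end

lemma map_alt_word: "map f (alt_word x y n) = alt_word (f x) (f y) n"
  by (induction x y n rule: alt_word.induct) auto

theorem theorem5p1:
  fixes m k :: nat
    and G :: "gen sword set monoid"
    and s t \<Delta> :: "gen sword set"
    and M :: "gen sword set set"
    and HN GM :: "gen sword set substructure"
  assumes "m = 2 * k" and "m \<ge> 4"
    and "G = dihedral_artin m"
    and "s = pres_gen (dihedral_rel m) S"
    and "t = pres_gen (dihedral_rel m) T"
    and "M = submonoid_generated G {s, t}"
    and "\<Delta> = list_mult G (alt_word s t m)"
    and "GM = \<lparr> subgrp = generate G {t}, posmon = submonoid_generated G {t}, garside = t \<rparr>"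
    and "HN = \<lparr> subgrp = generate G {s}, posmon = submonoid_generated G {s}, garside = s \<rparr>"
  shows "condition_A G M \<Delta> HN GM (k - 1) \<and> condition_B G M \<Delta> HN GM (k - 1)"
proof -
  interpret dihedral k
    using assms(1,2) by unfold_locales simp
  have st: "s = el [S]" "t = el [T]"
    using assms(1,4,5) by (simp_all add: pres_gen_def el_def)
  have "\<Delta> = delta"
    using list_mult_el[of "alt_word S T (2 * k)"]
    by (simp add: assms(1,3,7) st map_alt_word delta_def)
  then show ?thesis
    using condition_A_dihedral[of HN GM] condition_B_dihedral[of HN GM]
    by (simp add: assms(1,3,6,8,9) st)
qed

end
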